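(* Let $X=\{X_t\colon t\ge0\}$ be a real-valued Lévy process, let $r>0$ be a discount rate, and let $g\colon\mathbb{R}\to[0,\infty)$ be a continuous reward function. Assume that there exist a point $x_0\in\mathbb{R}$ and a continuous non-decreasing function $Q\colon\mathbb{R}\to\mathbb{R}$ with $Q(x)=0$ for $x\le x_0$, such that $$g(x)=\mathbf{E}_x Q(M)\quad\text{for all } x\ge x_0.$$ Assume that $Q\in C^2[x_0,\infty)$ and that $$|Q''(x)|\le A e^{\alpha x}\quad\text{for all } x\ge x_0,$$ for some $A>0$ and some $\alpha>0$. Assume moreover that $$\mathbf{E}_0\, e^{\alpha X_1}<e^{r}.$$ Then the function $$V(x)=\mathbf{E}_x Q(M),\quad x\in\mathbb{R},$$ satisfies $$V'(x_0+)-V'(x_0-)=Q'(x_0+)\,\mathbf{P}_0(M=0)$$ and $$V'(x+)-V'(x-)=0\quad\text{for all } x>x_0.$$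
   Context: Under $\mathbf{P}_x$ the Lévy process $X$ starts from $X_0=x$, and $\mathbf{E}_x$ is the corresponding expectation. The random variable $M=\sup\{X_t\colon 0\le t\le e_r\}$ is the supremum of $X$ up to $e_r$, where $e_r$ is an exponential random variable with parameter $r$ (mean $1/r$), independent of $X$. The notation $f'(x+)$ and $f'(x-)$ denotes the right and left derivatives of $f$ at $x$. The condition $Q\in C^2[x_0,\infty)$ refers to the restriction of $Q$ to $[x_0,\infty)$, with one-sided (right) derivatives at $x_0$. (The function $V$ is the candidate value function of the optimal stopping problem $\sup_\tau \mathbf{E}_x(e^{-r\tau}g(X_\tau))$.) *)

theory Defs
  imports "HOL-Probability.Probability"
begin

definition cadlag :: "(real \<Rightarrow> real) \<Rightarrow> bool" where
  "cadlag f \<longleftrightarrow>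
     (\<forall>t\<ge>0. continuous (at_right t) f) \<and>
     (\<forall>t>0. \<exists>l. (f \<longlongrightarrow> l) (at_left t))"

text \<open>
  Real-valued Levy process issued from 0, with time set \<open>[0,\<infinity>)\<close>; the values of \<open>X t\<close> for
  \<open>t < 0\<close> are irrelevant. Every path, not merely almost every path, is cadlag, so that suprema
  over time intervals are measurable although the probability space need not be complete.
  Stochastic continuity follows from right-continuity and stationarity of the increments.
\<close>

definition levy_process :: "'a measure \<Rightarrow> (real \<Rightarrow> 'a \<Rightarrow> real) \<Rightarrow> bool" where
  "levy_process N X \<longleftrightarrow>
     prob_space N \<and>
     (\<forall>t\<ge>0. X t \<in> borel_measurable N) \<and>
     (AE \<omega> in N. X 0 \<omega> = 0) \<and>
     (\<forall>(n::nat) (t::nat \<Rightarrow> real). 0 \<le> t 0 \<longrightarrow> (\<forall>i<n. t i < t (Suc i)) \<longrightarrow>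
        prob_space.indep_vars N (\<lambda>_. borel) (\<lambda>i \<omega>. X (t (Suc i)) \<omega> - X (t i) \<omega>) {..<n}) \<and>
     (\<forall>s\<ge>0. \<forall>t\<ge>0. distr N borel (\<lambda>\<omega>. X (s + t) \<omega> - X s \<omega>) = distr N borel (X t)) \<and>
     (\<forall>\<omega>\<in>space N. cadlag (\<lambda>t. X t \<omega>))"

text \<open>Independence of \<open>e\<close> from the sigma-algebra generated by \<open>X t\<close>, \<open>t \<ge> 0\<close>.\<close>

definition indep_of_process :: "'a measure \<Rightarrow> ('a \<Rightarrow> real) \<Rightarrow> (real \<Rightarrow> 'a \<Rightarrow> real) \<Rightarrow> bool" where
  "indep_of_process N e X \<longleftrightarrow>
     prob_space.indep_set N
       {e -` B \<inter> space N | B. B \<in> sets borel}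
       (sigma_sets (space N) {X t -` B \<inter> space N | t B. 0 \<le> t \<and> B \<in> sets borel})"

text \<open>
  The usual family of laws \<open>P x\<close> on one measurable space: under \<open>P 0\<close> the process \<open>X\<close> is a
  Levy process issued from 0 and \<open>e\<close> is an independent exponential time with parameter \<open>r\<close>;
  under \<open>P x\<close> the pair \<open>(e, X)\<close> has the law of \<open>(e, x + X)\<close> under \<open>P 0\<close>. In particular, under
  every \<open>P x\<close> the process starts from \<open>x\<close> and \<open>e\<close> is exponential and independent of \<open>X\<close>.
\<close>

definition levy_family ::
  "real \<Rightarrow> (real \<Rightarrow> 'a measure) \<Rightarrow> (real \<Rightarrow> 'a \<Rightarrow> real) \<Rightarrow> ('a \<Rightarrow> real) \<Rightarrow> bool" where
  "levy_family r P X e \<longleftrightarrow>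
     levy_process (P 0) X \<and>
     distributed (P 0) lborel e (exponential_density r) \<and>
     indep_of_process (P 0) e X \<and>
     (\<forall>x. sets (P x) = sets (P 0) \<and>
        distr (P x) (borel \<Otimes>\<^sub>M (\<Pi>\<^sub>M t\<in>{0..}. borel)) (\<lambda>\<omega>. (e \<omega>, \<lambda>t\<in>{0..}. X t \<omega>)) =
        distr (P 0) (borel \<Otimes>\<^sub>M (\<Pi>\<^sub>M t\<in>{0..}. borel)) (\<lambda>\<omega>. (e \<omega>, \<lambda>t\<in>{0..}. x + X t \<omega>)))"

definition sup_until :: "(real \<Rightarrow> 'a \<Rightarrow> real) \<Rightarrow> ('a \<Rightarrow> real) \<Rightarrow> 'a \<Rightarrow> real" where
  "sup_until X e \<omega> = (SUP t\<in>{0..e \<omega>}. X t \<omega>)"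

end

theory Submission
  imports Defs
begin

text \<open>
  Since the pair of the exponential time and the process under \<open>P x\<close> is the pair under \<open>P 0\<close>
  shifted by \<open>x\<close>, we have \<open>V x = E Q(x + M)\<close> under \<open>P 0\<close>, with \<open>M \<ge> 0\<close>. The bound on \<open>Q''\<close> makes
  \<open>Q\<close> locally Lipschitz with a constant of order \<open>exp (\<alpha> x)\<close>, so once \<open>exp (\<alpha> M)\<close> is integrable one
  may differentiate under the expectation from either side. The only point at which the two
  one-sided derivatives of \<open>Q\<close> may differ is \<open>x\<^sub>0\<close>, and \<open>x\<^sub>0 + M\<close> hits it exactly when \<open>M = 0\<close>.

  For the integrability of \<open>exp (\<alpha> M)\<close>, Ottaviani's inequality on dyadic grids compares the tail of
  the supremum over \<open>[j, j + 1]\<close> with that of \<open>X (j + 1)\<close>, up to a factor \<open>2\<close> and a shift \<open>b\<close>. Hence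
  the part of \<open>E exp (\<alpha> M)\<close> coming from \<open>[j, j + 1]\<close> is at most a constant times
  \<open>exp (- r j) (E exp (\<alpha> X\<^sub>1))^(j + 1)\<close>, and these bounds form a convergent geometric series.
\<close>

subsection \<open>Suprema of cadlag functions\<close>

lemma cadlag_const_add:
  assumes "cadlag f"
  shows "cadlag (\<lambda>t. c + f t)"
  unfolding cadlag_def
proof (intro conjI allI impI)
  fix t :: real assume "t > 0"
  with assms obtain l where "(f \<longlongrightarrow> l) (at_left t)" by (auto simp: cadlag_def)
  then show "\<exists>l. ((\<lambda>t. c + f t) \<longlongrightarrow> l) (at_left t)"
    by (intro exI[of _ "c + l"] tendsto_intros)
qed (use assms in \<open>auto simp: cadlag_def intro: continuous_intros\<close>)

lemma cadlag_uminus: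
  assumes "cadlag f"
  shows "cadlag (\<lambda>t. - f t)"
  unfolding cadlag_def
proof (intro conjI allI impI)
  fix t :: real assume "t > 0"
  with assms obtain l where "(f \<longlongrightarrow> l) (at_left t)" by (auto simp: cadlag_def)
  then show "\<exists>l. ((\<lambda>t. - f t) \<longlongrightarrow> l) (at_left t)"
    by (intro exI[of _ "- l"] tendsto_intros)
qed (use assms in \<open>auto simp: cadlag_def intro: continuous_intros\<close>)

text \<open>Compactness: the one-sided limits at each point of \<open>{0..T}\<close> give a ball on
  which \<open>f\<close> is bounded, and finitely many such balls cover the interval.\<close>

lemma cadlag_bounded:
  assumes f: "cadlag f"
  shows "bounded (f ` {0..T})"
proof -
  have "\<exists>d B. 0 < d \<and> (\<forall>s\<in>{0..T} \<inter> ball t d. \<bar>f s\<bar> \<le> B)" if t: "t \<in> {0..T}" for t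
  proof -
    have "((\<lambda>s. \<bar>f s\<bar>) \<longlongrightarrow> \<bar>f t\<bar>) (at_right t)"
      using f t by (intro tendsto_rabs) (auto simp: cadlag_def continuous_within)
    then have "eventually (\<lambda>s. \<bar>f s\<bar> < \<bar>f t\<bar> + 1) (at_right t)"
      by (rule order_tendstoD) simp
    then obtain b where b: "b > t" "\<And>y. y > t \<Longrightarrow> y < b \<Longrightarrow> \<bar>f y\<bar> < \<bar>f t\<bar> + 1"
      by (auto simp: eventually_at_right_field)
    have "\<exists>a<t. \<exists>B. \<forall>s. 0 \<le> s \<longrightarrow> a < s \<longrightarrow> s < t \<longrightarrow> \<bar>f s\<bar> < B"
    \<comment> \<open>To the left of \<open>0\<close> there are no admissible times, so any negative
      \<open>a\<close> serves there.\<close>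
    proof (cases "t = 0")
      case True
      then show ?thesis by (intro exI[of _ "-1"]) auto
    next
      case False
      with t have "0 < t" by auto
      with f obtain l where "(f \<longlongrightarrow> l) (at_left t)" by (auto simp: cadlag_def)
      then have "((\<lambda>s. \<bar>f s\<bar>) \<longlongrightarrow> \<bar>l\<bar>) (at_left t)" by (rule tendsto_rabs)
      then have "eventually (\<lambda>s. \<bar>f s\<bar> < \<bar>l\<bar> + 1) (at_left t)"
        by (rule order_tendstoD) simp
      then show ?thesis by (auto simp: eventually_at_left_field)
    qed
    then obtain a B where a: "a < t" "\<And>s. 0 \<le> s \<Longrightarrow> a < s \<Longrightarrow> s < t \<Longrightarrow> \<bar>f s\<bar> < B" by blast
    have "\<bar>f s\<bar> \<le> max B (\<bar>f t\<bar> + 1)" if s: "s \<in> {0..T} \<inter> ball t (min (b - t) (t - a))" for s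
    proof (cases s t rule: linorder_cases)
      case less
      with s have "\<bar>f s\<bar> < B" by (intro a) (auto simp: dist_real_def)
      then show ?thesis by linarith
    next
      case greater
      with s have "\<bar>f s\<bar> < \<bar>f t\<bar> + 1" by (intro b) (auto simp: dist_real_def)
      then show ?thesis by linarith
    qed auto
    then show ?thesis
      using a(1) b(1) by (intro exI[of _ "min (b - t) (t - a)"] exI[of _ "max B (\<bar>f t\<bar> + 1)"]) auto
  qed
  then obtain d B where dB: "\<And>t. t \<in> {0..T} \<Longrightarrow> 0 < d t"
    "\<And>t s. t \<in> {0..T} \<Longrightarrow> s \<in> {0..T} \<inter> ball t (d t) \<Longrightarrow> \<bar>f s\<bar> \<le> B t"
    by metis
  obtain C where C: "C \<subseteq> {0..T}" "finite C" "{0..T} \<subseteq> (\<Union>t\<in>C. ball t (d t))"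
  proof (rule compactE_image[of "{0..T}" "{0..T}" "\<lambda>t. ball t (d t)"])
    show "{0..T} \<subseteq> (\<Union>t\<in>{0..T}. ball t (d t))"
      using dB(1) by force
  qed auto
  show ?thesis
    unfolding bounded_iff
  proof (intro exI ballI)
    fix y assume "y \<in> f ` {0..T}"
    then obtain s where s: "s \<in> {0..T}" "y = f s" by auto
    with C obtain t where t: "t \<in> C" "s \<in> ball t (d t)" by auto
    with C s dB(2)[of t s] have "\<bar>f s\<bar> \<le> B t" by auto
    also have "\<dots> \<le> (\<Sum>t\<in>C. \<bar>B t\<bar>)"
      using member_le_sum[of t C "\<lambda>t. \<bar>B t\<bar>"] t C by auto
    finally show "norm y \<le> (\<Sum>t\<in>C. \<bar>B t\<bar>)" using s by simp
  qed
qed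

lemma cadlag_bdd_above:
  assumes "cadlag f" "0 \<le> a"
  shows "bdd_above (f ` {a..b})"
  by (rule bounded_imp_bdd_above, rule bounded_subset[OF cadlag_bounded[OF assms(1), of b]])
     (use assms(2) in auto)

text \<open>The grid point following \<open>t\<close> lies strictly to the right of
  \<open>t\<close>, at distance at most \<open>(1 / 2) ^ n\<close>, so right-continuity applies. The
  \<open>Suc\<close> keeps it strictly to the right even when \<open>t\<close> is itself
  dyadic.\<close>

lemma cadlag_dyadic_tendsto:
  assumes f: "cadlag f" and t: "0 \<le> t"
  shows "(\<lambda>n. f (real (Suc (nat \<lfloor>2 ^ n * t\<rfloor>)) / 2 ^ n)) \<longlonglongrightarrow> f t"
proof -
  define G where "G n = real (Suc (nat \<lfloor>2 ^ n * t\<rfloor>)) / 2 ^ n" for n :: nat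
  have fl: "real (nat \<lfloor>2 ^ n * t\<rfloor>) \<le> 2 ^ n * t" "2 ^ n * t < real (Suc (nat \<lfloor>2 ^ n * t\<rfloor>))" for n :: nat
    using t by (simp_all, linarith+)
  have gt: "t < G n" for n
    using fl(2)[of n] by (simp add: G_def field_simps)
  have le: "G n \<le> t + (1 / 2) ^ n" for n
    using fl(1)[of n] by (simp add: G_def field_simps power_divide)
  have "(\<lambda>n. t + (1 / 2) ^ n) \<longlonglongrightarrow> t + (0::real)"
    by (intro tendsto_intros) auto
  then have "G \<longlonglongrightarrow> t"
    using gt le by (intro real_tendsto_sandwich[of "\<lambda>_. t" G _ "\<lambda>n. t + (1 / 2) ^ n"])
      (auto intro!: always_eventually less_imp_le)
  then have "filterlim G (at_right t) sequentially"
    using gt by (auto simp: filterlim_at less_imp_neq[THEN not_sym])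
  then show ?thesis
    using f t filterlim_compose[of f "nhds (f t)" "at_right t" G sequentially]
    by (auto simp: cadlag_def continuous_within G_def)
qed

lemma cadlag_Max_tendsto_SUP:
  assumes f: "cadlag f" and s: "0 \<le> s"
  shows "(\<lambda>n. MAX i\<in>{..Suc (nat \<lfloor>2 ^ n * s\<rfloor>)}. f (real i / 2 ^ n)) \<longlonglongrightarrow> (SUP t\<in>{0..s}. f t)"
proof (rule order_tendstoI)
  have bdd: "bdd_above (f ` {0..s})" by (rule cadlag_bdd_above[OF f]) simp
  fix a assume "a < (SUP t\<in>{0..s}. f t)"
  then obtain t where t: "t \<in> {0..s}" "a < f t"
    using s bdd by (subst (asm) less_cSUP_iff) auto
  then have "\<forall>\<^sub>F n in sequentially. a < f (real (Suc (nat \<lfloor>2 ^ n * t\<rfloor>)) / 2 ^ n)"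
    by (intro order_tendstoD(1)[OF cadlag_dyadic_tendsto[OF f]]) auto
  then show "\<forall>\<^sub>F n in sequentially. a < (MAX i\<in>{..Suc (nat \<lfloor>2 ^ n * s\<rfloor>)}. f (real i / 2 ^ n))"
  proof eventually_elim
    case (elim n)
    have "nat \<lfloor>2 ^ n * t\<rfloor> \<le> nat \<lfloor>2 ^ n * s\<rfloor>"
      using t by (intro nat_mono floor_mono mult_left_mono) auto
    then show ?case
      using elim by (subst Max_gr_iff) (auto simp del: of_nat_Suc)
  qed
next
  have bdd: "bdd_above (f ` {0..s})" by (rule cadlag_bdd_above[OF f]) simp
  fix a assume a: "(SUP t\<in>{0..s}. f t) < a"
  have le: "f t < a" if "0 \<le> t" "t \<le> s" for t
    using cSUP_upper[of t "{0..s}" f] that bdd a by auto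
  have "(f \<longlongrightarrow> f s) (at_right s)"
    using f s by (auto simp: cadlag_def continuous_within)
  then have "eventually (\<lambda>t. f t < a) (at_right s)"
    by (rule order_tendstoD) (use le s in auto)
  then obtain b where b: "b > s" "\<And>t. t > s \<Longrightarrow> t < b \<Longrightarrow> f t < a"
    by (auto simp: eventually_at_right_field)
  have "(\<lambda>n. (1 / 2) ^ n) \<longlonglongrightarrow> (0::real)"
    by (intro tendsto_intros) auto
  then have "\<forall>\<^sub>F n in sequentially. (1 / 2) ^ n < b - s"
    by (rule order_tendstoD) (use b in auto)
  then show "\<forall>\<^sub>F n in sequentially. (MAX i\<in>{..Suc (nat \<lfloor>2 ^ n * s\<rfloor>)}. f (real i / 2 ^ n)) < a"
  proof eventually_elim
    case (elim n)
    have "f (real i / 2 ^ n) < a" if i: "i \<le> Suc (nat \<lfloor>2 ^ n * s\<rfloor>)" for i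
    proof (cases "real i / 2 ^ n \<le> s")
      case False
      have "real i \<le> 1 + real (nat \<lfloor>2 ^ n * s\<rfloor>)" using i by linarith
      also have "\<dots> \<le> 1 + 2 ^ n * s" using s by (simp add: of_nat_nat)
      finally have "real i / 2 ^ n \<le> s + (1 / 2) ^ n" by (simp add: field_simps power_divide)
      with elim False show ?thesis by (intro b) auto
    qed (auto intro: le)
    then show ?case by (subst Max_less_iff) auto
  qed
qed

text \<open>Writes the event that the supremum exceeds \<open>u\<close> as a countable union over
  grids. With integer end points both ends of the interval belong to every grid, so no overshoot
  occurs.\<close>

lemma cadlag_less_SUP_iff:
  assumes f: "cadlag f"
  shows "u < (SUP t\<in>{real j..real (Suc j)}. f t) \<longleftrightarrow>
    (\<exists>n. \<exists>i\<in>{j * 2 ^ n..Suc j * 2 ^ n}. u < f (real i / 2 ^ n))"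
proof -
  have "u < (SUP t\<in>{real j..real (Suc j)}. f t) \<longleftrightarrow> (\<exists>t\<in>{real j..real (Suc j)}. u < f t)"
    by (rule less_cSUP_iff) (auto intro!: cadlag_bdd_above f)
  also have "\<dots> \<longleftrightarrow> (\<exists>n. \<exists>i\<in>{j * 2 ^ n..Suc j * 2 ^ n}. u < f (real i / 2 ^ n))"
  proof safe
    fix t assume t: "t \<in> {real j..real (Suc j)}" "u < f t"
    show "\<exists>n. \<exists>i\<in>{j * 2 ^ n..Suc j * 2 ^ n}. u < f (real i / 2 ^ n)"
    \<comment> \<open>Approximation from the right would leave the interval at its right end point,
      but that point already lies on the grid of level \<open>0\<close>.\<close>
    proof (cases "t = real (Suc j)")
      case True
      with t show ?thesis by (intro exI[of _ 0] bexI[of _ "Suc j"]) auto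
    next
      case False
      have "\<forall>\<^sub>F n in sequentially. u < f (real (Suc (nat \<lfloor>2 ^ n * t\<rfloor>)) / 2 ^ n)"
        using t by (intro order_tendstoD(1)[OF cadlag_dyadic_tendsto[OF f]]) auto
      then obtain n :: nat where n: "u < f (real (Suc (nat \<lfloor>2 ^ n * t\<rfloor>)) / 2 ^ n)"
        by (auto simp: eventually_sequentially)
      have t': "real j \<le> t" "t < real (Suc j)" using t False by auto
      have "int (j * 2 ^ n) \<le> \<lfloor>2 ^ n * t\<rfloor>"
        using t' by (subst le_floor_iff) (simp add: mult.commute)
      moreover have "\<lfloor>2 ^ n * t\<rfloor> < int (Suc j * 2 ^ n)"
        using mult_strict_left_mono[OF t'(2), of "2 ^ n"] by (subst floor_less_iff) (simp add: algebra_simps)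
      ultimately have "Suc (nat \<lfloor>2 ^ n * t\<rfloor>) \<in> {j * 2 ^ n..Suc j * 2 ^ n}"
        unfolding atLeastAtMost_iff by linarith
      with n show ?thesis by blast
    qed
  next
    fix n i assume i: "i \<in> {j * 2 ^ n..Suc j * 2 ^ n}" "u < f (real i / 2 ^ n)"
    have "real (j * 2 ^ n) \<le> real i" "real i \<le> real (Suc j * 2 ^ n)"
      using i unfolding of_nat_le_iff by auto
    then have "real i / 2 ^ n \<in> {real j..real (Suc j)}"
      by (auto simp: field_simps)
    with i show "\<exists>t\<in>{real j..real (Suc j)}. u < f t" by blast
  qed
  finally show ?thesis .
qed

subsection \<open>Maximal inequality and exponential tails\<close>

text \<open>Decompose according to the first index \<open>i\<close> in \<open>{a..N}\<close> at
  which the partial sum exceeds \<open>u\<close>. This event depends on the first \<open>i\<close>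
  summands only, so it is independent of the event that the remaining sum is at least
  \<open>- b\<close>, which has probability at least \<open>p\<close>. When both occur, the full sum
  exceeds \<open>u - b\<close>.\<close>

lemma (in prob_space) ottaviani_inequality:
  fixes Y :: "nat \<Rightarrow> 'a \<Rightarrow> real"
  assumes indep: "indep_vars (\<lambda>_. borel) Y {..<N}"
    and lower: "\<And>i. a \<le> i \<Longrightarrow> i \<le> N \<Longrightarrow> p \<le> prob {\<omega>\<in>space M. - b \<le> (\<Sum>j\<in>{i..<N}. Y j \<omega>)}"
  shows "p * prob {\<omega>\<in>space M. \<exists>i\<in>{a..N}. u < (\<Sum>j<i. Y j \<omega>)}
    \<le> prob {\<omega>\<in>space M. u - b < (\<Sum>j<N. Y j \<omega>)}"
proof -
  have [measurable]: "\<And>j. j < N \<Longrightarrow> random_variable borel (Y j)"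
    using indep by (auto simp: indep_vars_def)
  \<comment> \<open>\<open>A i\<close> is the event of first passage above \<open>u\<close> at index
    \<open>i\<close>; \<open>D i\<close> is the event that the rest of the sum loses at most
    \<open>b\<close>.\<close>
  define A where "A i = {\<omega>\<in>space M. u < (\<Sum>j<i. Y j \<omega>) \<and> (\<forall>l\<in>{a..<i}. (\<Sum>j<l. Y j \<omega>) \<le> u)}" for i
  define D where "D i = {\<omega>\<in>space M. - b \<le> (\<Sum>j\<in>{i..<N}. Y j \<omega>)}" for i
  have A[measurable]: "A i \<in> events" if "i \<le> N" for i
    using that unfolding A_def
    by (intro sets.sets_Collect_conj sets.sets_Collect_finite_All borel_measurable_less
        borel_measurable_le borel_measurable_const borel_measurable_sum) auto
  have D[measurable]: "D i \<in> events" for i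
    unfolding D_def by measurable
  have step: "p * prob (A i) \<le> prob (A i \<inter> D i)" if i: "a \<le> i" "i \<le> N" for i
  proof -
    \<comment> \<open>\<open>S\<close> and \<open>T\<close> describe \<open>A i\<close> and
      \<open>D i\<close> as sets of coordinates, so that independence of the two disjoint blocks of
      summands can be applied.\<close>
    define S where "S = {y \<in> space (Pi\<^sub>M {..<i} (\<lambda>_. borel :: real measure)).
      u < (\<Sum>j<i. y j) \<and> (\<forall>l\<in>{a..<i}. (\<Sum>j<l. y j) \<le> u)}"
    define T where "T = {y \<in> space (Pi\<^sub>M {i..<N} (\<lambda>_. borel :: real measure)). - b \<le> (\<Sum>j\<in>{i..<N}. y j)}"
    have S: "S \<in> sets (Pi\<^sub>M {..<i} (\<lambda>_. borel))"
      unfolding S_def by measurable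
    have T: "T \<in> sets (Pi\<^sub>M {i..<N} (\<lambda>_. borel))"
      unfolding T_def by measurable
    have A_eq: "A i = (\<lambda>\<omega>. restrict (\<lambda>j. Y j \<omega>) {..<i}) -` S \<inter> space M"
      by (auto simp: A_def S_def space_PiM)
    have D_eq: "D i = (\<lambda>\<omega>. restrict (\<lambda>j. Y j \<omega>) {i..<N}) -` T \<inter> space M"
      by (auto simp: D_def T_def space_PiM)
    have "indep_var (Pi\<^sub>M {..<i} (\<lambda>_. borel)) (\<lambda>\<omega>. restrict (\<lambda>j. Y j \<omega>) {..<i})
        (Pi\<^sub>M {i..<N} (\<lambda>_. borel)) (\<lambda>\<omega>. restrict (\<lambda>j. Y j \<omega>) {i..<N})"
      using i by (intro indep_var_restrict[OF indep]) auto
    from indep_varD[OF this S T] have "prob (A i \<inter> D i) = prob (A i) * prob (D i)"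
      unfolding A_eq D_eq by (simp add: vimage_Times Int_ac Int_assoc[symmetric] vimage_def Collect_conj_eq[symmetric])
    then show ?thesis
      using mult_right_mono[OF lower[OF i], of "prob (A i)"] by (simp add: D_def mult.commute)
  qed
  have disj: "disjoint_family_on A {a..N}"
    unfolding disjoint_family_on_def
  proof (intro ballI impI)
    fix m n assume "m \<in> {a..N}" "n \<in> {a..N}" "m \<noteq> n"
    then show "A m \<inter> A n = {}"
      by (cases m n rule: linorder_cases) (force simp: A_def)+
  qed
  have "{\<omega>\<in>space M. \<exists>i\<in>{a..N}. u < (\<Sum>j<i. Y j \<omega>)} = (\<Union>i\<in>{a..N}. A i)"
  proof safe
    fix \<omega> i assume w: "\<omega> \<in> space M" "i \<in> {a..N}" "u < (\<Sum>j<i. Y j \<omega>)"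
    define k where "k = (LEAST k. a \<le> k \<and> u < (\<Sum>j<k. Y j \<omega>))"
    have "a \<le> k \<and> u < (\<Sum>j<k. Y j \<omega>)"
      unfolding k_def by (rule LeastI[of _ i]) (use w in auto)
    moreover have "k \<le> i"
      unfolding k_def by (rule Least_le) (use w in auto)
    moreover have "(\<Sum>j<l. Y j \<omega>) \<le> u" if "l \<in> {a..<k}" for l
      using not_less_Least[of l "\<lambda>k. a \<le> k \<and> u < (\<Sum>j<k. Y j \<omega>)"] that by (auto simp: k_def)
    ultimately show "\<omega> \<in> (\<Union>i\<in>{a..N}. A i)"
      using w by (auto simp: A_def)
  qed (auto simp: A_def)
  then have "p * prob {\<omega>\<in>space M. \<exists>i\<in>{a..N}. u < (\<Sum>j<i. Y j \<omega>)} = p * prob (\<Union>i\<in>{a..N}. A i)"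
    by simp
  also have "\<dots> = (\<Sum>i\<in>{a..N}. p * prob (A i))"
    by (subst finite_measure_finite_Union) (auto simp: disj sum_distrib_left)
  also have "\<dots> \<le> (\<Sum>i\<in>{a..N}. prob (A i \<inter> D i))"
    by (intro sum_mono step) auto
  also have "\<dots> = prob (\<Union>i\<in>{a..N}. A i \<inter> D i)"
    using disj by (intro finite_measure_finite_Union[symmetric]) (auto simp: disjoint_family_on_def)
  also have "\<dots> \<le> prob {\<omega>\<in>space M. u - b < (\<Sum>j<N. Y j \<omega>)}"
  proof (rule finite_measure_mono)
    show "(\<Union>i\<in>{a..N}. A i \<inter> D i) \<subseteq> {\<omega>\<in>space M. u - b < (\<Sum>j<N. Y j \<omega>)}"
    proof safe
      fix i \<omega> assume i: "i \<in> {a..N}" and w: "\<omega> \<in> A i" "\<omega> \<in> D i"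
      have "(\<Sum>j<N. Y j \<omega>) = (\<Sum>j<i. Y j \<omega>) + (\<Sum>j\<in>{i..<N}. Y j \<omega>)"
        using i by (simp add: lessThan_atLeast0 sum.atLeastLessThan_concat)
      with w show "u - b < (\<Sum>j<N. Y j \<omega>)" by (auto simp: A_def D_def)
    qed (auto simp: A_def)
  qed measurable
  finally show ?thesis .
qed

text \<open>Each value of \<open>f\<close> is the length of the set of levels \<open>v\<close> with
  \<open>0 < v < f \<omega>\<close>, and Tonelli exchanges the two integrals. Negative values
  contribute nothing on either side, since \<open>ennreal\<close> truncates them to
  \<open>0\<close>.\<close>

lemma (in sigma_finite_measure) nn_integral_layer_cake:
  fixes f :: "'a \<Rightarrow> real"
  assumes [measurable]: "f \<in> borel_measurable M" "E \<in> sets M"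
  shows "(\<integral>\<^sup>+\<omega>. ennreal (f \<omega>) * indicator E \<omega> \<partial>M)
    = (\<integral>\<^sup>+v. emeasure M (E \<inter> {\<omega>\<in>space M. v < f \<omega>}) * indicator {0<..} v \<partial>lborel)"
proof -
  interpret pair_sigma_finite M lborel ..
  have "(\<integral>\<^sup>+\<omega>. ennreal (f \<omega>) * indicator E \<omega> \<partial>M)
      = (\<integral>\<^sup>+\<omega>. \<integral>\<^sup>+v. indicator E \<omega> * indicator {0<..} v * (if v < f \<omega> then 1 else 0) \<partial>lborel \<partial>M)"
  proof (rule nn_integral_cong)
    fix \<omega>
    have "(\<integral>\<^sup>+v. indicator E \<omega> * indicator {0<..} v * (if v < f \<omega> then 1 else 0) \<partial>lborel)
      = (\<integral>\<^sup>+v. indicator E \<omega> * indicator {0<..<f \<omega>} v \<partial>lborel)"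
      by (intro nn_integral_cong) (auto split: split_indicator)
    also have "\<dots> = indicator E \<omega> * emeasure lborel {0<..<f \<omega>}"
      by (subst nn_integral_cmult) auto
    also have "emeasure lborel {0<..<f \<omega>} = ennreal (f \<omega>)"
      by (cases "0 \<le> f \<omega>") (auto simp: ennreal_neg)
    finally show "ennreal (f \<omega>) * indicator E \<omega>
        = (\<integral>\<^sup>+v. indicator E \<omega> * indicator {0<..} v * (if v < f \<omega> then 1 else 0) \<partial>lborel)"
      by (simp add: mult.commute)
  qed
  also have "\<dots> = (\<integral>\<^sup>+v. \<integral>\<^sup>+\<omega>. indicator E \<omega> * indicator {0<..} v * (if v < f \<omega> then 1 else 0) \<partial>M \<partial>lborel)"
    by (rule Fubini'[symmetric]) measurable
  also have "\<dots> = (\<integral>\<^sup>+v. emeasure M (E \<inter> {\<omega>\<in>space M. v < f \<omega>}) * indicator {0<..} v \<partial>lborel)"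
  proof (rule nn_integral_cong)
    fix v :: real
    have "(\<integral>\<^sup>+\<omega>. indicator E \<omega> * indicator {0<..} v * (if v < f \<omega> then 1 else 0) \<partial>M)
      = (\<integral>\<^sup>+\<omega>. indicator {0<..} v * indicator (E \<inter> {\<omega>\<in>space M. v < f \<omega>}) \<omega> \<partial>M)"
      by (intro nn_integral_cong) (auto split: split_indicator)
    also have "\<dots> = indicator {0<..} v * emeasure M (E \<inter> {\<omega>\<in>space M. v < f \<omega>})"
      by (subst nn_integral_cmult) auto
    finally show "(\<integral>\<^sup>+\<omega>. indicator E \<omega> * indicator {0<..} v * (if v < f \<omega> then 1 else 0) \<partial>M)
      = emeasure M (E \<inter> {\<omega>\<in>space M. v < f \<omega>}) * indicator {0<..} v"
      by (simp add: mult.commute)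
  qed
  finally show ?thesis .
qed

text \<open>Apply the layer-cake formula to both exponentials and compare level by level: exceeding
  \<open>v\<close> by the exponential means exceeding \<open>ln v / \<alpha>\<close> by the
  variable.\<close>

lemma (in sigma_finite_measure) nn_integral_exp_le_of_tail_le:
  fixes W Z :: "'a \<Rightarrow> real"
  assumes [measurable]: "W \<in> borel_measurable M" "Z \<in> borel_measurable M" "E \<in> sets M"
    and \<alpha>: "0 < \<alpha>"
    and tail: "\<And>u. emeasure M (E \<inter> {\<omega>\<in>space M. u < W \<omega>}) \<le> c * emeasure M {\<omega>\<in>space M. u < Z \<omega>}"
  shows "(\<integral>\<^sup>+\<omega>. ennreal (exp (\<alpha> * W \<omega>)) * indicator E \<omega> \<partial>M) \<le> c * (\<integral>\<^sup>+\<omega>. ennreal (exp (\<alpha> * Z \<omega>)) \<partial>M)"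
proof -
  have less_exp: "v < exp (\<alpha> * w) \<longleftrightarrow> ln v / \<alpha> < w" if "0 < v" for v w :: real
  proof -
    have "v < exp (\<alpha> * w) \<longleftrightarrow> exp (ln v) < exp (\<alpha> * w)" using that by simp
    also have "\<dots> \<longleftrightarrow> ln v / \<alpha> < w" unfolding exp_less_cancel_iff using \<alpha> by (simp add: field_simps)
    finally show ?thesis .
  qed
  have "(\<integral>\<^sup>+\<omega>. ennreal (exp (\<alpha> * W \<omega>)) * indicator E \<omega> \<partial>M)
      = (\<integral>\<^sup>+v. emeasure M (E \<inter> {\<omega>\<in>space M. v < exp (\<alpha> * W \<omega>)}) * indicator {0<..} v \<partial>lborel)"
    by (rule nn_integral_layer_cake) measurable
  also have "\<dots> \<le> (\<integral>\<^sup>+v. c * (emeasure M (space M \<inter> {\<omega>\<in>space M. v < exp (\<alpha> * Z \<omega>)}) * indicator {0<..} v) \<partial>lborel)"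
  proof (rule nn_integral_mono)
    fix v :: real
    show "emeasure M (E \<inter> {\<omega>\<in>space M. v < exp (\<alpha> * W \<omega>)}) * indicator {0<..} v
        \<le> c * (emeasure M (space M \<inter> {\<omega>\<in>space M. v < exp (\<alpha> * Z \<omega>)}) * indicator {0<..} v)"
    proof (cases "0 < v")
      case True
      have "space M \<inter> {\<omega>\<in>space M. ln v / \<alpha> < Z \<omega>} = {\<omega>\<in>space M. ln v / \<alpha> < Z \<omega>}" by auto
      then show ?thesis using tail[of "ln v / \<alpha>"] True by (simp add: less_exp)
    qed simp
  qed
  also have "\<dots> = c * (\<integral>\<^sup>+v. emeasure M (space M \<inter> {\<omega>\<in>space M. v < exp (\<alpha> * Z \<omega>)}) * indicator {0<..} v \<partial>lborel)"
    by (rule nn_integral_cmult) measurable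
  also have "(\<integral>\<^sup>+v. emeasure M (space M \<inter> {\<omega>\<in>space M. v < exp (\<alpha> * Z \<omega>)}) * indicator {0<..} v \<partial>lborel)
      = (\<integral>\<^sup>+\<omega>. ennreal (exp (\<alpha> * Z \<omega>)) * indicator (space M) \<omega> \<partial>M)"
    by (rule nn_integral_layer_cake[symmetric]) measurable
  also have "\<dots> = (\<integral>\<^sup>+\<omega>. ennreal (exp (\<alpha> * Z \<omega>)) \<partial>M)"
    by (intro nn_integral_cong) auto
  finally show ?thesis .
qed

lemma (in prob_space) random_variable_bounded_half:
  fixes I :: "'a \<Rightarrow> real"
  assumes [measurable]: "random_variable borel I"
  shows "\<exists>b. 1 / 2 \<le> prob {\<omega>\<in>space M. I \<omega> \<le> b}"
proof -
  have "(\<lambda>n. prob {\<omega>\<in>space M. I \<omega> \<le> real n}) \<longlonglongrightarrow> prob (\<Union>n. {\<omega>\<in>space M. I \<omega> \<le> real n})"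
    by (rule finite_Lim_measure_incseq) (auto simp: incseq_def)
  also have "(\<Union>n. {\<omega>\<in>space M. I \<omega> \<le> real n}) = space M"
    by (auto intro: real_arch_simple)
  finally have "(\<lambda>n. prob {\<omega>\<in>space M. I \<omega> \<le> real n}) \<longlonglongrightarrow> 1"
    by (simp add: prob_space)
  then have "\<forall>\<^sub>F n in sequentially. 1 / 2 < prob {\<omega>\<in>space M. I \<omega> \<le> real n}"
    by (rule order_tendstoD) simp
  then show ?thesis
    by (auto simp: eventually_sequentially intro: less_imp_le)
qed

subsection \<open>Exponential moments of the killed supremum\<close>

text \<open>The measure \<open>M\<close> is arbitrary, so that the result also applies to the
  sigma-algebra generated by the process alone, as independence from the exponential time
  requires.\<close>

lemma borel_measurable_SUP_cadlag:
  fixes X :: "real \<Rightarrow> 'a \<Rightarrow> real"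
  assumes X: "\<And>t. 0 \<le> t \<Longrightarrow> X t \<in> borel_measurable M"
    and cadlag: "\<And>\<omega>. \<omega> \<in> space M \<Longrightarrow> cadlag (\<lambda>t. X t \<omega>)"
  shows "(\<lambda>\<omega>. SUP t\<in>{real j..real (Suc j)}. X t \<omega>) \<in> borel_measurable M"
  unfolding borel_measurable_iff_greater
proof
  fix u
  have [measurable]: "X (real i / 2 ^ n) \<in> borel_measurable M" for i n by (rule X) simp
  have "{\<omega>\<in>space M. u < (SUP t\<in>{real j..real (Suc j)}. X t \<omega>)}
    = {\<omega>\<in>space M. \<exists>n. \<exists>i\<in>{j * 2 ^ n..Suc j * 2 ^ n}. u < X (real i / 2 ^ n) \<omega>}"
    using cadlag_less_SUP_iff[OF cadlag] by blast
  also have "\<dots> \<in> sets M" by measurable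
  finally show "{\<omega>\<in>space M. u < (SUP t\<in>{real j..real (Suc j)}. X t \<omega>)} \<in> sets M" .
qed

section \<open>Tails and exponential moments of a Levy process on unit intervals\<close>

lemma levy_process_grid_indep:
  assumes "levy_process N X"
  shows "prob_space.indep_vars N (\<lambda>_. borel)
    (\<lambda>k \<omega>. X (real (Suc k) / 2 ^ m) \<omega> - X (real k / 2 ^ m) \<omega>) {..<n}"
proof -
  have "prob_space.indep_vars N (\<lambda>_. borel) (\<lambda>i \<omega>. X (t (Suc i)) \<omega> - X (t i) \<omega>) {..<n}"
    if "0 \<le> t 0" "\<And>i. i < n \<Longrightarrow> t i < t (Suc i)" for t :: "nat \<Rightarrow> real"
    using assms that by (auto simp: levy_process_def)
  from this[of "\<lambda>k. real k / 2 ^ m"] show ?thesis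
    by (simp add: divide_strict_right_mono del: of_nat_Suc)
qed

text \<open>Provides the shift in Ottaviani's inequality, uniformly in \<open>s\<close>: the
  supremum of \<open>- X\<close> over \<open>[0, 1]\<close> is a finite random variable, so some
  \<open>b\<close> bounds it with probability at least one half, and it dominates every
  \<open>- X s\<close>.\<close>

lemma levy_process_lower_bound:
  assumes levy: "levy_process N X"
  shows "\<exists>b. \<forall>s\<in>{0..1}. 1 / 2 \<le> measure N {\<omega>\<in>space N. - b \<le> X s \<omega>}"
proof -
  interpret prob_space N using levy by (simp add: levy_process_def)
  have X[measurable]: "X t \<in> borel_measurable N" if "0 \<le> t" for t
    using levy that by (simp add: levy_process_def)
  have cadlag: "cadlag (\<lambda>t. - X t \<omega>)" if "\<omega> \<in> space N" for \<omega>
    using levy that by (intro cadlag_uminus) (simp add: levy_process_def)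
  define I where "I \<omega> = (SUP t\<in>{real 0..real (Suc 0)}. - X t \<omega>)" for \<omega>
  have "random_variable borel I"
    unfolding I_def by (intro borel_measurable_SUP_cadlag cadlag) simp
  then obtain b where b: "1 / 2 \<le> prob {\<omega>\<in>space N. I \<omega> \<le> b}"
    using random_variable_bounded_half by blast
  have "1 / 2 \<le> prob {\<omega>\<in>space N. - b \<le> X s \<omega>}" if s: "s \<in> {0..1}" for s
  proof -
    have "- X s \<omega> \<le> I \<omega>" if "\<omega> \<in> space N" for \<omega>
      unfolding I_def by (rule cSUP_upper) (use s in \<open>auto intro!: cadlag_bdd_above cadlag that\<close>)
    then have "{\<omega>\<in>space N. I \<omega> \<le> b} \<subseteq> {\<omega>\<in>space N. - b \<le> X s \<omega>}"
      by force
    then have "prob {\<omega>\<in>space N. I \<omega> \<le> b} \<le> prob {\<omega>\<in>space N. - b \<le> X s \<omega>}"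
      using s by (intro finite_measure_mono) auto
    with b show ?thesis by simp
  qed
  then show ?thesis by blast
qed

text \<open>Ottaviani's inequality on the grid of mesh \<open>1 / 2 ^ n\<close> with
  \<open>p = 1 / 2\<close>. By stationarity the increment from a grid point of
  \<open>[j, j + 1]\<close> to time \<open>j + 1\<close> has the law of \<open>X\<close> at a time
  in \<open>[0, 1]\<close>, so \<open>b\<close> controls it. The bound does not depend on
  \<open>n\<close> and passes to the limit.\<close>

lemma levy_process_SUP_tail:
  assumes levy: "levy_process N X"
    and b: "\<And>s. s \<in> {0..1} \<Longrightarrow> 1 / 2 \<le> measure N {\<omega>\<in>space N. - b \<le> X s \<omega>}"
  shows "measure N {\<omega>\<in>space N. u < (SUP t\<in>{real j..real (Suc j)}. X t \<omega>)}
    \<le> 2 * measure N {\<omega>\<in>space N. u - b < X (real (Suc j)) \<omega>}"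
proof -
  interpret prob_space N using levy by (simp add: levy_process_def)
  have X[measurable]: "X t \<in> borel_measurable N" if "0 \<le> t" for t
    using levy that by (simp add: levy_process_def)
  have cadlag: "cadlag (\<lambda>t. X t \<omega>)" if "\<omega> \<in> space N" for \<omega>
    using levy that by (simp add: levy_process_def)
  have X0: "AE \<omega> in N. X 0 \<omega> = 0"
    using levy by (simp add: levy_process_def)
  have stat: "prob {\<omega>\<in>space N. - b \<le> X (s + t) \<omega> - X s \<omega>} = prob {\<omega>\<in>space N. - b \<le> X t \<omega>}"
    if "0 \<le> s" "0 \<le> t" for s t
  proof -
    have "measure (distr N borel (\<lambda>\<omega>. X (s + t) \<omega> - X s \<omega>)) {- b..} = measure (distr N borel (X t)) {- b..}"
      using levy that by (simp add: levy_process_def)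
    then show ?thesis
      using that by (simp add: measure_distr vimage_def Int_def conj_commute)
  qed
  define A where "A n = {\<omega>\<in>space N. \<exists>i\<in>{j * 2 ^ n..Suc j * 2 ^ n}. u < X (real i / 2 ^ n) \<omega>}" for n
  have A: "A n \<in> events" for n unfolding A_def by measurable
  \<comment> \<open>Dyadic grids are nested: point \<open>i\<close> of level \<open>n\<close> is
    point \<open>2 * i\<close> of level \<open>n + 1\<close>.\<close>
  have "incseq A"
  proof (rule incseq_SucI, rule subsetI)
    fix n \<omega> assume "\<omega> \<in> A n"
    then obtain i where "\<omega> \<in> space N" "i \<in> {j * 2 ^ n..Suc j * 2 ^ n}" "u < X (real i / 2 ^ n) \<omega>"
      by (auto simp: A_def)
    then show "\<omega> \<in> A (Suc n)"
      by (auto simp: A_def intro!: bexI[of _ "2 * i"])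
  qed
  then have "(\<lambda>n. prob (A n)) \<longlonglongrightarrow> prob (\<Union>n. A n)"
    using A by (intro finite_Lim_measure_incseq) auto
  moreover have "(\<Union>n. A n) = {\<omega>\<in>space N. u < (SUP t\<in>{real j..real (Suc j)}. X t \<omega>)}"
  proof (rule set_eqI)
    fix \<omega>
    show "\<omega> \<in> (\<Union>n. A n) \<longleftrightarrow> \<omega> \<in> {\<omega>\<in>space N. u < (SUP t\<in>{real j..real (Suc j)}. X t \<omega>)}"
      using cadlag_less_SUP_iff[OF cadlag, of \<omega> u j]
      by (cases "\<omega> \<in> space N") (simp_all add: A_def del: of_nat_Suc mult_Suc)
  qed
  moreover have "prob (A n) \<le> 2 * prob {\<omega>\<in>space N. u - b < X (real (Suc j)) \<omega>}" for n
  proof -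
    let ?Y = "\<lambda>k \<omega>. X (real (Suc k) / 2 ^ n) \<omega> - X (real k / 2 ^ n) \<omega>"
    have sum: "(\<Sum>k<i. ?Y k \<omega>) = X (real i / 2 ^ n) \<omega> - X 0 \<omega>" for i \<omega>
      by (subst sum_lessThan_telescope) simp
    have sum': "(\<Sum>k\<in>{i..<Suc j * 2 ^ n}. ?Y k \<omega>) = X (real (Suc j)) \<omega> - X (real i / 2 ^ n) \<omega>"
      if "i \<le> Suc j * 2 ^ n" for i \<omega>
      using that by (subst sum_Suc_diff') (auto simp del: mult_Suc of_nat_Suc simp: of_nat_mult)
    have "1 / 2 * prob {\<omega>\<in>space N. \<exists>i\<in>{j * 2 ^ n..Suc j * 2 ^ n}. u < (\<Sum>k<i. ?Y k \<omega>)}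
      \<le> prob {\<omega>\<in>space N. u - b < (\<Sum>k<Suc j * 2 ^ n. ?Y k \<omega>)}"
    proof (rule ottaviani_inequality)
      show "indep_vars (\<lambda>_. borel) ?Y {..<Suc j * 2 ^ n}"
        by (rule levy_process_grid_indep[OF levy])
      fix i assume i: "j * 2 ^ n \<le> i" "i \<le> Suc j * 2 ^ n"
      then have "real (j * 2 ^ n) \<le> real i" "real i \<le> real (Suc j * 2 ^ n)"
        unfolding of_nat_le_iff by auto
      then have d: "real (Suc j) - real i / 2 ^ n \<in> {0..1}"
        by (auto simp: field_simps)
      have "1 / 2 \<le> prob {\<omega>\<in>space N. - b \<le> X (real (Suc j) - real i / 2 ^ n) \<omega>}"
        by (rule b[OF d])
      also have "\<dots> = prob {\<omega>\<in>space N. - b \<le> X (real (Suc j)) \<omega> - X (real i / 2 ^ n) \<omega>}"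
        using stat[of "real i / 2 ^ n" "real (Suc j) - real i / 2 ^ n"] d by simp
      finally show "1 / 2 \<le> prob {\<omega>\<in>space N. - b \<le> (\<Sum>k\<in>{i..<Suc j * 2 ^ n}. ?Y k \<omega>)}"
        unfolding sum'[OF i(2)] .
    qed
    \<comment> \<open>The sums telescope to \<open>X - X 0\<close>, which agrees with
      \<open>X\<close> only almost surely.\<close>
    moreover have "prob {\<omega>\<in>space N. \<exists>i\<in>{j * 2 ^ n..Suc j * 2 ^ n}. u < (\<Sum>k<i. ?Y k \<omega>)} = prob (A n)"
      unfolding sum A_def by (intro measure_eq_AE) (use X0 in \<open>auto elim!: eventually_mono\<close>)
    moreover have "prob {\<omega>\<in>space N. u - b < (\<Sum>k<Suc j * 2 ^ n. ?Y k \<omega>)}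
        = prob {\<omega>\<in>space N. u - b < X (real (Suc j)) \<omega>}"
      unfolding sum by (intro measure_eq_AE)
        (use X0 in \<open>auto elim!: eventually_mono simp del: of_nat_Suc mult_Suc simp: of_nat_mult\<close>)
    ultimately show ?thesis by simp
  qed
  ultimately show ?thesis
    by (metis (no_types, lifting) LIMSEQ_le_const2)
qed

text \<open>\<open>X n\<close> is almost surely the sum of \<open>n\<close> independent unit
  increments, each distributed as \<open>X 1\<close>, so the expectation of the product of
  exponentials factorizes. Nonnegative integrals make this valid for infinite moments too.\<close>

lemma levy_process_exp_moment:
  assumes levy: "levy_process N X"
  shows "(\<integral>\<^sup>+\<omega>. ennreal (exp (\<alpha> * X (real n) \<omega>)) \<partial>N) = (\<integral>\<^sup>+\<omega>. ennreal (exp (\<alpha> * X 1 \<omega>)) \<partial>N) ^ n"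
proof -
  interpret prob_space N using levy by (simp add: levy_process_def)
  have X[measurable]: "X t \<in> borel_measurable N" if "0 \<le> t" for t
    using levy that by (simp add: levy_process_def)
  have X0: "AE \<omega> in N. X 0 \<omega> = 0"
    using levy by (simp add: levy_process_def)
  let ?Y = "\<lambda>k \<omega>. X (real (Suc k)) \<omega> - X (real k) \<omega>"
  have step: "(\<integral>\<^sup>+\<omega>. ennreal (exp (\<alpha> * ?Y k \<omega>)) \<partial>N) = (\<integral>\<^sup>+\<omega>. ennreal (exp (\<alpha> * X 1 \<omega>)) \<partial>N)" for k
  proof -
    have "distr N borel (?Y k) = distr N borel (X 1)"
    proof -
      have "distr N borel (\<lambda>\<omega>. X (real k + 1) \<omega> - X (real k) \<omega>) = distr N borel (X 1)"
        using levy by (simp add: levy_process_def)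
      then show ?thesis by (simp add: add.commute)
    qed
    then have "(\<integral>\<^sup>+x. ennreal (exp (\<alpha> * x)) \<partial>distr N borel (?Y k))
        = (\<integral>\<^sup>+x. ennreal (exp (\<alpha> * x)) \<partial>distr N borel (X 1))" by simp
    then show ?thesis by (simp add: nn_integral_distr)
  qed
  have "(\<integral>\<^sup>+\<omega>. ennreal (exp (\<alpha> * X (real n) \<omega>)) \<partial>N)
      = (\<integral>\<^sup>+\<omega>. (\<Prod>k<n. ennreal (exp (\<alpha> * ?Y k \<omega>))) \<partial>N)"
  proof (rule nn_integral_cong_AE)
    show "AE \<omega> in N. ennreal (exp (\<alpha> * X (real n) \<omega>)) = (\<Prod>k<n. ennreal (exp (\<alpha> * ?Y k \<omega>)))"
      using X0
    proof eventually_elim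
      case (elim \<omega>)
      have "(\<Sum>k<n. ?Y k \<omega>) = X (real n) \<omega>"
        using elim by (subst sum_lessThan_telescope) simp
      then have "\<alpha> * X (real n) \<omega> = (\<Sum>k<n. \<alpha> * ?Y k \<omega>)"
        by (simp only: sum_distrib_left[symmetric])
      then show ?case by (simp add: exp_sum prod_ennreal)
    qed
  qed
  also have "\<dots> = (\<Prod>k<n. \<integral>\<^sup>+\<omega>. ennreal (exp (\<alpha> * ?Y k \<omega>)) \<partial>N)"
  proof (rule indep_vars_nn_integral)
    show "indep_vars (\<lambda>_. borel) (\<lambda>k \<omega>. ennreal (exp (\<alpha> * ?Y k \<omega>))) {..<n}"
    proof (rule indep_vars_compose2[where X = ?Y and Y = "\<lambda>_ x. ennreal (exp (\<alpha> * x))"])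
      show "indep_vars (\<lambda>_. borel) ?Y {..<n}"
        using levy_process_grid_indep[OF levy, of 0 n] by (simp del: of_nat_Suc)
    qed simp
  qed auto
  also have "\<dots> = (\<integral>\<^sup>+\<omega>. ennreal (exp (\<alpha> * X 1 \<omega>)) \<partial>N) ^ n"
    unfolding step by simp
  finally show ?thesis .
qed

text \<open>The event \<open>j < e\<close> has probability \<open>exp (- j * r)\<close> and is
  independent of the path. This multiplies the tail bound for the supremum by that factor, and the
  tail comparison turns it into a bound by the exponential moment of
  \<open>b + X (j + 1)\<close>.\<close>

lemma levy_process_killed_SUP_exp_moment:
  assumes levy: "levy_process N X" and indep: "indep_of_process N e X"
    and exp: "distributed N lborel e (exponential_density r)" and r: "0 < r" and \<alpha>: "0 < \<alpha>"
    and b: "\<And>s. s \<in> {0..1} \<Longrightarrow> 1 / 2 \<le> measure N {\<omega>\<in>space N. - b \<le> X s \<omega>}"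
  shows "(\<integral>\<^sup>+\<omega>. ennreal (exp (\<alpha> * (SUP t\<in>{real j..real (Suc j)}. X t \<omega>)))
      * indicator {\<omega>\<in>space N. real j < e \<omega>} \<omega> \<partial>N)
    \<le> ennreal (2 * exp (- real j * r) * exp (\<alpha> * b)) * (\<integral>\<^sup>+\<omega>. ennreal (exp (\<alpha> * X 1 \<omega>)) \<partial>N) ^ Suc j"
proof -
  interpret prob_space N using levy by (simp add: levy_process_def)
  have X[measurable]: "X t \<in> borel_measurable N" if "0 \<le> t" for t
    using levy that by (simp add: levy_process_def)
  have cadlag: "cadlag (\<lambda>t. X t \<omega>)" if "\<omega> \<in> space N" for \<omega>
    using levy that by (simp add: levy_process_def)
  have [measurable]: "e \<in> borel_measurable N"
    using exp by (simp add: distributed_def)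
  define W where "W \<omega> = (SUP t\<in>{real j..real (Suc j)}. X t \<omega>)" for \<omega>
  define E where "E = {\<omega>\<in>space N. real j < e \<omega>}"
  have [measurable]: "E \<in> events" unfolding E_def by measurable
  have [measurable]: "random_variable borel W"
    unfolding W_def by (intro borel_measurable_SUP_cadlag cadlag X)
  have tail: "emeasure N (E \<inter> {\<omega>\<in>space N. u < W \<omega>})
      \<le> ennreal (2 * exp (- real j * r)) * emeasure N {\<omega>\<in>space N. u < b + X (real (Suc j)) \<omega>}" for u
  proof -
    \<comment> \<open>Independence speaks of the sigma-algebra generated by the process, so
      measurability of \<open>W\<close> is established with respect to \<open>\<Sigma>\<close> and
      not merely with respect to \<open>N\<close>.\<close>
    define G where "G = {X t -` B \<inter> space N | t B. 0 \<le> t \<and> B \<in> sets (borel :: real measure)}"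
    have G: "G \<subseteq> Pow (space N)" by (auto simp: G_def)
    define \<Sigma> where "\<Sigma> = sigma (space N) G"
    have sets_\<Sigma>: "sets \<Sigma> = sigma_sets (space N) G" and space_\<Sigma>: "space \<Sigma> = space N"
      using G by (simp_all add: \<Sigma>_def)
    have "W \<in> borel_measurable \<Sigma>"
      unfolding W_def
    proof (intro borel_measurable_SUP_cadlag)
      fix t :: real assume "0 \<le> t"
      then show "X t \<in> borel_measurable \<Sigma>"
        by (intro measurableI) (auto simp: sets_\<Sigma> space_\<Sigma> G_def)
    qed (simp add: space_\<Sigma> cadlag)
    then have "{\<omega>\<in>space \<Sigma>. u < W \<omega>} \<in> sets \<Sigma>"
      by measurable
    then have "{\<omega>\<in>space N. u < W \<omega>} \<in> sigma_sets (space N) G"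
      by (simp add: sets_\<Sigma> space_\<Sigma>)
    moreover have "E \<in> {e -` B \<inter> space N | B. B \<in> sets borel}"
      unfolding E_def by (intro CollectI exI[of _ "{real j<..}"]) auto
    ultimately have "prob (E \<inter> {\<omega>\<in>space N. u < W \<omega>}) = prob E * prob {\<omega>\<in>space N. u < W \<omega>}"
      using indep unfolding indep_of_process_def G_def by (intro indep_setD) auto
    also have "prob E = exp (- real j * r)"
      unfolding E_def using exponential_distributedD_gt[OF exp, of "real j"] r by simp
    also have "exp (- real j * r) * prob {\<omega>\<in>space N. u < W \<omega>}
        \<le> exp (- real j * r) * (2 * prob {\<omega>\<in>space N. u - b < X (real (Suc j)) \<omega>})"
      unfolding W_def by (intro mult_left_mono levy_process_SUP_tail[OF levy b]) auto
    also have "{\<omega>\<in>space N. u - b < X (real (Suc j)) \<omega>} = {\<omega>\<in>space N. u < b + X (real (Suc j)) \<omega>}"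
      by auto
    finally show ?thesis
      by (simp add: emeasure_eq_measure ennreal_mult[symmetric] mult_ac del: of_nat_Suc)
  qed
  have "(\<integral>\<^sup>+\<omega>. ennreal (exp (\<alpha> * W \<omega>)) * indicator E \<omega> \<partial>N)
      \<le> ennreal (2 * exp (- real j * r)) * (\<integral>\<^sup>+\<omega>. ennreal (exp (\<alpha> * (b + X (real (Suc j)) \<omega>))) \<partial>N)"
    by (rule nn_integral_exp_le_of_tail_le) (use \<alpha> tail in \<open>auto simp del: of_nat_Suc\<close>)
  also have "(\<integral>\<^sup>+\<omega>. ennreal (exp (\<alpha> * (b + X (real (Suc j)) \<omega>))) \<partial>N)
      = (\<integral>\<^sup>+\<omega>. ennreal (exp (\<alpha> * b)) * ennreal (exp (\<alpha> * X (real (Suc j)) \<omega>)) \<partial>N)"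
    by (simp add: distrib_left exp_add ennreal_mult)
  also have "\<dots> = ennreal (exp (\<alpha> * b)) * (\<integral>\<^sup>+\<omega>. ennreal (exp (\<alpha> * X (real (Suc j)) \<omega>)) \<partial>N)"
    by (rule nn_integral_cmult) (simp del: of_nat_Suc)
  also have "\<dots> = ennreal (exp (\<alpha> * b)) * (\<integral>\<^sup>+\<omega>. ennreal (exp (\<alpha> * X 1 \<omega>)) \<partial>N) ^ Suc j"
    unfolding levy_process_exp_moment[OF levy] ..
  finally show ?thesis
    unfolding W_def E_def by (simp add: ennreal_mult mult.assoc)
qed

section \<open>The supremum up to the exponential time: finite exponential moment and
  nonnegativity\<close>

lemma (in prob_space) exponential_distributed_AE_pos:
  assumes e: "distributed M lborel e (exponential_density r)" and r: "0 < r"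
  shows "AE \<omega> in M. 0 < e \<omega>"
proof -
  have [measurable]: "random_variable borel e"
    using e by (simp add: distributed_def)
  have "prob {\<omega>\<in>space M. 0 < e \<omega>} = 1"
    using exponential_distributedD_gt[OF e, of 0] r by simp
  then show ?thesis
    by (subst prob_Collect_eq_1[symmetric]) auto
qed

text \<open>The supremum up to \<open>e\<close> is at most the largest of the suprema over the unit
  intervals that start before \<open>e\<close>, so its exponential is bounded by the sum of their
  exponentials. The expectations of these terms are dominated by a geometric series of ratio
  \<open>c * exp (- r) < 1\<close>.\<close>

lemma levy_process_sup_until_exp_moment:
  assumes levy: "levy_process N X" and indep: "indep_of_process N e X"
    and exp: "distributed N lborel e (exponential_density r)" and r: "0 < r" and \<alpha>: "0 < \<alpha>"
    and moment: "(\<integral>\<^sup>+\<omega>. ennreal (exp (\<alpha> * X 1 \<omega>)) \<partial>N) < ennreal (exp r)"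
  shows "(\<integral>\<^sup>+\<omega>. ennreal (exp (\<alpha> * sup_until X e \<omega>)) \<partial>N) < \<infinity>"
proof -
  interpret prob_space N using levy by (simp add: levy_process_def)
  have X[measurable]: "X t \<in> borel_measurable N" if "0 \<le> t" for t
    using levy that by (simp add: levy_process_def)
  have cadlag: "cadlag (\<lambda>t. X t \<omega>)" if "\<omega> \<in> space N" for \<omega>
    using levy that by (simp add: levy_process_def)
  have [measurable]: "e \<in> borel_measurable N"
    using exp by (simp add: distributed_def)
  note e_pos = exponential_distributed_AE_pos[OF exp r]
  obtain b where b: "\<And>s. s \<in> {0..1} \<Longrightarrow> 1 / 2 \<le> measure N {\<omega>\<in>space N. - b \<le> X s \<omega>}"
    using levy_process_lower_bound[OF levy] by blast
  obtain c where c: "(\<integral>\<^sup>+\<omega>. ennreal (exp (\<alpha> * X 1 \<omega>)) \<partial>N) = ennreal c" "0 \<le> c" "c < exp r"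
    using moment by (cases "\<integral>\<^sup>+\<omega>. ennreal (exp (\<alpha> * X 1 \<omega>)) \<partial>N" rule: ennreal_cases)
      (auto simp: ennreal_less_iff)
  define W where "W j \<omega> = (SUP t\<in>{real j..real (Suc j)}. X t \<omega>)" for j \<omega>
  have [measurable]: "random_variable borel (W j)" for j
    unfolding W_def by (intro borel_measurable_SUP_cadlag cadlag X)
  let ?f = "\<lambda>j \<omega>. ennreal (exp (\<alpha> * W j \<omega>)) * indicator {\<omega>\<in>space N. real j < e \<omega>} \<omega>"
  have term_le_suminf: "f k \<le> (\<Sum>j. f j)" for f :: "nat \<Rightarrow> ennreal" and k
    using sum_le_suminf[of f "{k}"] by auto
  have "(\<integral>\<^sup>+\<omega>. ennreal (exp (\<alpha> * sup_until X e \<omega>)) \<partial>N) \<le> (\<integral>\<^sup>+\<omega>. (\<Sum>j. ?f j \<omega>) \<partial>N)"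
  proof (rule nn_integral_mono_AE)
    show "AE \<omega> in N. ennreal (exp (\<alpha> * sup_until X e \<omega>)) \<le> (\<Sum>j. ?f j \<omega>)"
      using e_pos AE_space
    proof eventually_elim
      case (elim \<omega>)
      \<comment> \<open>Ceiling minus one, and not the floor, makes \<open>m < e\<close> strict even
        when \<open>e\<close> is an integer, so the indicator of the interval starting at
        \<open>m\<close> equals \<open>1\<close>.\<close>
      define m where "m = nat (\<lceil>e \<omega>\<rceil> - 1)"
      have m: "real m < e \<omega>" "e \<omega> \<le> real (Suc m)"
        using elim unfolding m_def by linarith+
      have "Max ((\<lambda>j. W j \<omega>) ` {..m}) \<in> (\<lambda>j. W j \<omega>) ` {..m}"
        by (intro Max_in) auto
      then obtain k where "Max ((\<lambda>j. W j \<omega>) ` {..m}) = W k \<omega>" "k \<in> {..m}"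
        by (rule imageE)
      then have k: "k \<le> m" "W k \<omega> = Max ((\<lambda>j. W j \<omega>) ` {..m})" by simp_all
      have "sup_until X e \<omega> \<le> W k \<omega>"
        unfolding sup_until_def
      proof (rule cSUP_least)
        fix t assume t: "t \<in> {0..e \<omega>}"
        \<comment> \<open>The minimum matters only for \<open>t = m + 1\<close>, whose floor is
          \<open>m + 1\<close> although it belongs to the interval starting at
          \<open>m\<close>.\<close>
        define i where "i = min m (nat \<lfloor>t\<rfloor>)"
        have "t \<in> {real i..real (Suc i)}"
        proof (cases "nat \<lfloor>t\<rfloor> \<le> m")
          case True
          have "real (nat \<lfloor>t\<rfloor>) = of_int \<lfloor>t\<rfloor>" using t by simp
          moreover have "of_int \<lfloor>t\<rfloor> \<le> t" "t \<le> of_int \<lfloor>t\<rfloor> + 1" by linarith+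
          ultimately show ?thesis using True by (simp add: i_def add.commute)
        next
          case False
          then have "real m \<le> t" by linarith
          with False t m show ?thesis by (simp add: i_def)
        qed
        then have "X t \<omega> \<le> W i \<omega>"
          unfolding W_def by (intro cSUP_upper cadlag_bdd_above cadlag elim) auto
        also have "\<dots> \<le> W k \<omega>" unfolding k by (intro Max_ge) (auto simp: i_def)
        finally show "X t \<omega> \<le> W k \<omega>" .
      qed (use elim in auto)
      then have "ennreal (exp (\<alpha> * sup_until X e \<omega>)) \<le> ?f k \<omega>"
        using elim m k \<alpha> by (auto simp: ennreal_leI)
      also have "\<dots> \<le> (\<Sum>j. ?f j \<omega>)"
        by (rule term_le_suminf)
      finally show ?case .
    qed
  qed
  also have "\<dots> = (\<Sum>j. \<integral>\<^sup>+\<omega>. ?f j \<omega> \<partial>N)"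
    by (rule nn_integral_suminf) measurable
  also have "\<dots> \<le> (\<Sum>j. ennreal (2 * exp (\<alpha> * b) * c * (c * exp (- r)) ^ j))"
  proof (intro suminf_le summableI)
    fix j
    have "(\<integral>\<^sup>+\<omega>. ?f j \<omega> \<partial>N) \<le> ennreal (2 * exp (- real j * r) * exp (\<alpha> * b)) * ennreal c ^ Suc j"
      using levy_process_killed_SUP_exp_moment[OF levy indep exp r \<alpha> b, of j] unfolding W_def c(1) .
    also have "\<dots> = ennreal (2 * exp (- real j * r) * exp (\<alpha> * b) * c ^ Suc j)"
      using c(2) by (simp add: ennreal_power ennreal_mult[symmetric] del: power_Suc)
    also have "2 * exp (- real j * r) * exp (\<alpha> * b) * c ^ Suc j = 2 * exp (\<alpha> * b) * c * (c * exp (- r)) ^ j"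
      by (simp add: power_mult_distrib exp_of_nat_mult[symmetric] mult_ac)
    finally show "(\<integral>\<^sup>+\<omega>. ?f j \<omega> \<partial>N) \<le> ennreal (2 * exp (\<alpha> * b) * c * (c * exp (- r)) ^ j)" .
  qed
  also have "\<dots> < \<infinity>"
  proof -
    have "c * exp (- r) < exp r * exp (- r)" using c by (intro mult_strict_right_mono) auto
    then have "c * exp (- r) < 1" by (simp add: exp_add[symmetric])
    then have "summable (\<lambda>j. 2 * exp (\<alpha> * b) * c * (c * exp (- r)) ^ j)"
      using c by (intro summable_mult summable_geometric) auto
    then show ?thesis
      using c by (subst suminf_ennreal2) auto
  qed
  finally show ?thesis .
qed

lemma levy_process_sup_until_nonneg:
  assumes levy: "levy_process N X"
    and exp: "distributed N lborel e (exponential_density r)" and r: "0 < r"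
  shows "AE \<omega> in N. 0 \<le> sup_until X e \<omega>"
proof -
  interpret prob_space N using levy by (simp add: levy_process_def)
  have "AE \<omega> in N. X 0 \<omega> = 0"
    using levy by (simp add: levy_process_def)
  then show ?thesis
    using exponential_distributed_AE_pos[OF exp r] AE_space
  proof eventually_elim
    case (elim \<omega>)
    then have "cadlag (\<lambda>t. X t \<omega>)"
      using levy by (simp add: levy_process_def)
    then have "X 0 \<omega> \<le> sup_until X e \<omega>"
      unfolding sup_until_def using elim by (intro cSUP_upper cadlag_bdd_above) auto
    with elim show ?case by simp
  qed
qed

subsection \<open>Transfer between the laws of the family\<close>

text \<open>
  The supremum up to a random time, written as a limit over dyadic grids so that it is measurable
  in the time and the path jointly. The first branch is the value of \<open>sup_until\<close> on an empty interval.
\<close>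

definition path_sup :: "real \<times> (real \<Rightarrow> real) \<Rightarrow> real" where
  "path_sup = (\<lambda>(s, f). if s < 0 then Sup {} else
     lim (\<lambda>n. MAX i\<in>{..Suc (nat \<lfloor>2 ^ n * s\<rfloor>)}. f (real i / 2 ^ n)))"

text \<open>At a fixed level the grid depends on the time only through an integer, so countably many
  cases suffice. In each one the maximum is over finitely many coordinates, and the limit in
  \<open>n\<close> preserves measurability.\<close>

lemma borel_measurable_path_sup [measurable]:
  "path_sup \<in> borel_measurable (borel \<Otimes>\<^sub>M (\<Pi>\<^sub>M t\<in>{0..}. borel))"
proof -
  have "(\<lambda>p. MAX i\<in>{..Suc (nat \<lfloor>2 ^ n * fst p :: real\<rfloor>)}. snd p (real i / 2 ^ n))
      \<in> borel_measurable (borel \<Otimes>\<^sub>M (\<Pi>\<^sub>M t\<in>{0::real..}. borel :: real measure))" for n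
  proof (rule measurable_compose_countable[where g = "\<lambda>p. nat \<lfloor>2 ^ n * fst p :: real\<rfloor>"
        and f = "\<lambda>k p. MAX i\<in>{..Suc k}. snd p (real i / 2 ^ n)"])
    fix k
    have "(\<lambda>p. snd p (real i / 2 ^ n)) \<in> borel_measurable (borel \<Otimes>\<^sub>M (\<Pi>\<^sub>M t\<in>{0::real..}. borel))" for i
      by (rule measurable_compose[OF measurable_snd], rule measurable_component_singleton) simp
    then show "(\<lambda>p. MAX i\<in>{..Suc k}. snd p (real i / 2 ^ n))
        \<in> borel_measurable (borel \<Otimes>\<^sub>M (\<Pi>\<^sub>M t\<in>{0::real..}. borel :: real measure))"
      by measurable
  qed measurable
  note [measurable] = this
  show ?thesis
    unfolding path_sup_def case_prod_beta by measurable
qed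

lemma path_sup_eq_SUP:
  assumes "cadlag f"
  shows "path_sup (s, restrict f {0..}) = (SUP t\<in>{0..s}. f t)"
  using limI[OF cadlag_Max_tendsto_SUP[OF assms, of s]] by (auto simp: path_sup_def)

text \<open>The laws are related only through the joint law of the time and the path on a product
  space. Writing \<open>sup_until\<close> as the measurable functional \<open>path_sup\<close> of
  this pair carries expectations under \<open>P x\<close> over to \<open>P 0\<close>.\<close>

lemma
  assumes family: "levy_family r P X e" and r: "0 < r"
  shows levy_family_sup_until_measurable: "sup_until X e \<in> borel_measurable (P 0)"
    and levy_family_integral_sup_until:
      "\<And>h :: real \<Rightarrow> real. h \<in> borel_measurable borel \<Longrightarrow>
        (\<integral>\<omega>. h (sup_until X e \<omega>) \<partial>P x) = (\<integral>\<omega>. h (x + sup_until X e \<omega>) \<partial>P 0)"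
proof -
  have levy: "levy_process (P 0) X" and exp: "distributed (P 0) lborel e (exponential_density r)"
    and sets_P: "\<And>x. sets (P x) = sets (P 0)"
    and law: "\<And>x. distr (P x) (borel \<Otimes>\<^sub>M (\<Pi>\<^sub>M t\<in>{0..}. borel)) (\<lambda>\<omega>. (e \<omega>, \<lambda>t\<in>{0..}. X t \<omega>)) =
        distr (P 0) (borel \<Otimes>\<^sub>M (\<Pi>\<^sub>M t\<in>{0..}. borel)) (\<lambda>\<omega>. (e \<omega>, \<lambda>t\<in>{0..}. x + X t \<omega>))"
    using family by (auto simp: levy_family_def)
  interpret prob_space "P 0" using levy by (simp add: levy_process_def)
  note [measurable_cong] = sets_P
  have X0[measurable]: "X t \<in> borel_measurable (P 0)" if "0 \<le> t" for t
    using levy that by (simp add: levy_process_def)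
  have X[measurable]: "X t \<in> borel_measurable (P x)" if "0 \<le> t" for t x
    using X0[OF that] measurable_cong_sets[OF sets_P refl] by blast
  have space_P: "space (P x) = space (P 0)" for x
    by (rule sets_eq_imp_space_eq[OF sets_P])
  have cadlag: "cadlag (\<lambda>t. X t \<omega>)" if "\<omega> \<in> space (P 0)" for \<omega>
    using levy that by (simp add: levy_process_def)
  have e0[measurable]: "e \<in> borel_measurable (P 0)"
    using exp by (simp add: distributed_def)
  have e[measurable]: "e \<in> borel_measurable (P x)" for x
    using e0 measurable_cong_sets[OF sets_P refl] by blast
  have path[measurable]: "(\<lambda>\<omega>. (e \<omega>, \<lambda>t\<in>{0..}. c + X t \<omega>))
      \<in> measurable (P x) (borel \<Otimes>\<^sub>M (\<Pi>\<^sub>M t\<in>{0..}. borel))" for x c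
    by (intro measurable_Pair measurable_restrict) auto
  have sup: "path_sup (e \<omega>, \<lambda>t\<in>{0..}. c + X t \<omega>) = (SUP t\<in>{0..e \<omega>}. c + X t \<omega>)"
    if "\<omega> \<in> space (P 0)" for \<omega> c
    by (intro path_sup_eq_SUP cadlag_const_add cadlag that)
  have sup0: "path_sup (e \<omega>, \<lambda>t\<in>{0..}. X t \<omega>) = sup_until X e \<omega>" if "\<omega> \<in> space (P 0)" for \<omega>
    unfolding sup_until_def using path_sup_eq_SUP cadlag[OF that] by simp
  have path0[measurable]: "(\<lambda>\<omega>. (e \<omega>, \<lambda>t\<in>{0..}. X t \<omega>))
      \<in> measurable (P x) (borel \<Otimes>\<^sub>M (\<Pi>\<^sub>M t\<in>{0..}. borel))" for x
    using path[of 0 x] by simp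
  have "(\<lambda>\<omega>. path_sup (e \<omega>, \<lambda>t\<in>{0..}. X t \<omega>)) \<in> borel_measurable (P 0)"
    by measurable
  then show M[measurable]: "sup_until X e \<in> borel_measurable (P 0)"
    by (subst (asm) measurable_cong[OF sup0])
  show "(\<integral>\<omega>. h (sup_until X e \<omega>) \<partial>P x) = (\<integral>\<omega>. h (x + sup_until X e \<omega>) \<partial>P 0)"
    if [measurable]: "h \<in> borel_measurable borel" for h :: "real \<Rightarrow> real"
  proof -
    have "(\<integral>\<omega>. h (sup_until X e \<omega>) \<partial>P x) = (\<integral>\<omega>. h (path_sup (e \<omega>, \<lambda>t\<in>{0..}. X t \<omega>)) \<partial>P x)"
      \<comment> \<open>All laws share one underlying space, so every path is cadlag under
        \<open>P x\<close> as well.\<close>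
      by (intro Bochner_Integration.integral_cong) (auto simp: space_P[of x] sup0)
    also have "\<dots> = (\<integral>p. h (path_sup p) \<partial>distr (P x) (borel \<Otimes>\<^sub>M (\<Pi>\<^sub>M t\<in>{0..}. borel)) (\<lambda>\<omega>. (e \<omega>, \<lambda>t\<in>{0..}. X t \<omega>)))"
      by (subst integral_distr) auto
    also have "\<dots> = (\<integral>\<omega>. h (path_sup (e \<omega>, \<lambda>t\<in>{0..}. x + X t \<omega>)) \<partial>P 0)"
      unfolding law by (subst integral_distr) auto
    also have "\<dots> = (\<integral>\<omega>. h (x + sup_until X e \<omega>) \<partial>P 0)"
    \<comment> \<open>The shift \<open>x\<close> leaves the supremum only if the time interval is
      nonempty, which holds almost surely because \<open>e\<close> is positive.\<close>
    proof (rule integral_cong_AE)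
      show "AE \<omega> in P 0. h (path_sup (e \<omega>, \<lambda>t\<in>{0..}. x + X t \<omega>)) = h (x + sup_until X e \<omega>)"
        using exponential_distributed_AE_pos[OF exp r] AE_space
      proof eventually_elim
        case (elim \<omega>)
        have "bdd_above ((\<lambda>t. X t \<omega>) ` {0..e \<omega>})"
          using elim by (intro cadlag_bdd_above cadlag) auto
        then have "(SUP t\<in>{0..e \<omega>}. x + X t \<omega>) = x + sup_until X e \<omega>"
          unfolding sup_until_def using elim
          by (intro Sup_add_eq) auto
        then show ?case using sup[OF elim(2)] by simp
      qed
    qed measurable
    finally show ?thesis .
  qed
qed

subsection \<open>Differentiation under the expectation\<close>

text \<open>The function \<open>g\<close> with derivative \<open>A * exp (\<alpha> * y)\<close>
  dominates \<open>f\<close> in slope, so \<open>f + g\<close> and \<open>g - f\<close> are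
  non-decreasing on the half-line. The bound serves twice: from \<open>Q''\<close> to
  \<open>Q'\<close>, and from \<open>Q'\<close> to \<open>Q\<close>.\<close>

lemma exp_growth_of_deriv_bound:
  fixes f f' :: "real \<Rightarrow> real"
  assumes deriv: "\<And>x. a \<le> x \<Longrightarrow> (f has_real_derivative f' x) (at x within {a..})"
    and bound: "\<And>x. a \<le> x \<Longrightarrow> \<bar>f' x\<bar> \<le> A * exp (\<alpha> * x)"
    and A: "0 \<le> A" and \<alpha>: "0 < \<alpha>"
  shows "\<exists>C\<ge>0. \<forall>x\<ge>a. \<bar>f x\<bar> \<le> C * exp (\<alpha> * x)"
\<comment> \<open>The first summand absorbs the initial value \<open>f a\<close>, since
  \<open>exp (\<alpha> * (x - a))\<close> is at least \<open>1\<close>; the second comes from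
  \<open>g\<close>.\<close>
proof (intro exI[of _ "\<bar>f a\<bar> * exp (- \<alpha> * a) + A / \<alpha>"] conjI allI impI)
  fix x assume x: "a \<le> x"
  define g where "g y = A / \<alpha> * exp (\<alpha> * y)" for y
  have g: "(g has_real_derivative A * exp (\<alpha> * y)) (at y within S)" for y S
    unfolding g_def using \<alpha> by (auto intro!: derivative_eq_intros)
  have mono: "h a \<le> h x" if "\<And>y. a \<le> y \<Longrightarrow> (h has_real_derivative h' y) (at y within {a..})"
      "\<And>y. a \<le> y \<Longrightarrow> 0 \<le> h' y" for h h' :: "real \<Rightarrow> real"
  proof (cases "a = x")
    case False
    have "\<exists>y\<in>{a<..<x}. h x - h a = (\<lambda>d. d * h' y) (x - a)"
    proof (rule mvt_simple)
      show "a < x" using x False by simp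
      fix y assume "a \<le> y" "y \<le> x"
      then have "(h has_real_derivative h' y) (at y within {a..x})"
        by (intro DERIV_subset[OF that(1)]) auto
      then show "(h has_derivative (\<lambda>d. d * h' y)) (at y within {a..x})"
        by (simp add: has_field_derivative_def mult.commute[of _ "h' y"])
    qed
    then obtain y where y: "y \<in> {a<..<x}" "h x - h a = (x - a) * h' y" by auto
    have "0 \<le> (x - a) * h' y" using that(2)[of y] x y(1) by (intro mult_nonneg_nonneg) auto
    then show ?thesis using y(2) by simp
  qed simp
  have "f a + g a \<le> f x + g x"
    by (rule mono[where h = "\<lambda>y. f y + g y" and h' = "\<lambda>y. f' y + A * exp (\<alpha> * y)"])
      (use bound in \<open>auto intro!: derivative_intros deriv g simp: abs_le_iff\<close>, smt (verit) bound)
  moreover have "g a - f a \<le> g x - f x"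
    by (rule mono[where h = "\<lambda>y. g y - f y" and h' = "\<lambda>y. A * exp (\<alpha> * y) - f' y"])
      (use bound in \<open>auto intro!: derivative_intros deriv g simp: abs_le_iff\<close>)
  moreover have "0 \<le> g a" unfolding g_def using A \<alpha> by simp
  ultimately have "\<bar>f x\<bar> \<le> \<bar>f a\<bar> + g x" by linarith
  also have "\<dots> \<le> \<bar>f a\<bar> * exp (- \<alpha> * a) * exp (\<alpha> * x) + g x"
  proof -
    have "1 \<le> exp (- \<alpha> * a) * exp (\<alpha> * x)"
      using \<alpha> x by (simp add: exp_add[symmetric])
    then have "\<bar>f a\<bar> * 1 \<le> \<bar>f a\<bar> * (exp (- \<alpha> * a) * exp (\<alpha> * x))"
      by (intro mult_left_mono) auto
    then show ?thesis by (simp add: mult.assoc)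
  qed
  finally show "\<bar>f x\<bar> \<le> (\<bar>f a\<bar> * exp (- \<alpha> * a) + A / \<alpha>) * exp (\<alpha> * x)"
    by (simp add: g_def distrib_right)
qed (use A \<alpha> in auto)

text \<open>As \<open>f\<close> vanishes up to \<open>a\<close>, it factors through the projection
  \<open>max x a\<close>, which is 1-Lipschitz. The mean value bound is thus needed only on
  \<open>{a..z}\<close>, and a kink at \<open>a\<close> does no harm.\<close>

lemma exp_lipschitz_of_deriv_bound:
  fixes f f' :: "real \<Rightarrow> real"
  assumes zero: "\<And>x. x \<le> a \<Longrightarrow> f x = 0"
    and deriv: "\<And>x. a \<le> x \<Longrightarrow> (f has_real_derivative f' x) (at x within {a..})"
    and bound: "\<And>x. a \<le> x \<Longrightarrow> \<bar>f' x\<bar> \<le> C * exp (\<alpha> * x)"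
    and C: "0 \<le> C" and \<alpha>: "0 < \<alpha>"
    and x: "x \<le> z" and y: "y \<le> z" and z: "a \<le> z"
  shows "\<bar>f x - f y\<bar> \<le> C * exp (\<alpha> * z) * \<bar>x - y\<bar>"
proof -
  have proj: "f x = f (max x a)" for x
    by (cases "x \<le> a") (simp_all add: zero max_def)
  have "norm (f (max x a) - f (max y a)) \<le> C * exp (\<alpha> * z) * norm (max x a - max y a)"
  proof (rule field_differentiable_bound[where S = "{a..z}" and f' = f'])
    fix u assume u: "u \<in> {a..z}"
    then show "(f has_field_derivative f' u) (at u within {a..z})"
      by (intro DERIV_subset[OF deriv]) auto
    have "\<bar>f' u\<bar> \<le> C * exp (\<alpha> * u)" using u by (intro bound) auto
    also have "\<dots> \<le> C * exp (\<alpha> * z)" using u C \<alpha> by (intro mult_left_mono) auto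
    finally show "norm (f' u) \<le> C * exp (\<alpha> * z)" by simp
  qed (use x y z in auto)
  also have "\<dots> \<le> C * exp (\<alpha> * z) * \<bar>x - y\<bar>"
    using C by (intro mult_left_mono) auto
  finally show ?thesis by (simp add: proj[symmetric])
qed

lemma has_real_derivative_shift_within:
  fixes f :: "real \<Rightarrow> real"
  assumes "(f has_real_derivative d) (at (x + m) within T)" "\<And>y. y \<in> S \<Longrightarrow> y + m \<in> T"
  shows "((\<lambda>y. f (y + m)) has_real_derivative d) (at x within S)"
proof -
  have "(f has_real_derivative d) (at (x + m) within (\<lambda>y. y + m) ` S)"
    by (rule DERIV_subset[OF assms(1)]) (use assms(2) in auto)
  moreover have "((\<lambda>y. y + m) has_real_derivative 1) (at x within S)"
    by (auto intro!: derivative_eq_intros)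
  ultimately show ?thesis
    using DERIV_image_chain[of f d "\<lambda>y. y + m" x S 1] by (simp add: comp_def)
qed

text \<open>Dominated convergence for the difference quotients: they are bounded by the local
  Lipschitz constant, which is a multiple of \<open>exp (\<alpha> * M')\<close>. A general set
  \<open>S\<close> with its own derivative \<open>D\<close> covers the left, right and two-sided
  cases at once.\<close>

lemma (in prob_space) has_real_derivative_expectation_shift:
  fixes M' :: "'a \<Rightarrow> real" and f f' D :: "real \<Rightarrow> real"
  assumes [measurable]: "random_variable borel M'" "f \<in> borel_measurable borel"
      "D \<in> borel_measurable borel"
    and nonneg: "AE \<omega> in M. 0 \<le> M' \<omega>"
    and integrable: "integrable M (\<lambda>\<omega>. exp (\<alpha> * M' \<omega>))"
    and zero: "\<And>x. x \<le> a \<Longrightarrow> f x = 0"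
    and deriv: "\<And>x. a \<le> x \<Longrightarrow> (f has_real_derivative f' x) (at x within {a..})"
    and bound: "\<And>x. a \<le> x \<Longrightarrow> \<bar>f' x\<bar> \<le> C * exp (\<alpha> * x)"
    and C: "0 \<le> C" and \<alpha>: "0 < \<alpha>"
    and D: "\<And>m. 0 \<le> m \<Longrightarrow> ((\<lambda>y. f (y + m)) has_real_derivative D m) (at x within S)"
  shows "((\<lambda>y. expectation (\<lambda>\<omega>. f (y + M' \<omega>))) has_real_derivative expectation (\<lambda>\<omega>. D (M' \<omega>)))
      (at x within S)"
  unfolding has_field_derivative_iff tendsto_at_iff_sequentially
proof (intro allI impI)
  fix u :: "nat \<Rightarrow> real"
  assume u: "\<forall>i. u i \<in> S - {x}" "u \<longlonglongrightarrow> x"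
  obtain C' where C': "\<And>y. a \<le> y \<Longrightarrow> \<bar>f y\<bar> \<le> C' * exp (\<alpha> * y)" "0 \<le> C'"
    using exp_growth_of_deriv_bound[OF deriv bound C \<alpha>] by auto
  have f_integrable: "integrable M (\<lambda>\<omega>. f (y + M' \<omega>))" for y
  proof (rule Bochner_Integration.integrable_bound)
    show "integrable M (\<lambda>\<omega>. C' * exp (\<alpha> * y) * exp (\<alpha> * M' \<omega>))"
      using integrable by simp
    have "\<bar>f z\<bar> \<le> C' * exp (\<alpha> * z)" for z
      using C' zero[of z] by (cases "a \<le> z") auto
    from this[of "y + _"] show "AE \<omega> in M. norm (f (y + M' \<omega>)) \<le> norm (C' * exp (\<alpha> * y) * exp (\<alpha> * M' \<omega>))"
      using C'(2) by (simp add: distrib_left exp_add abs_mult mult.assoc)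
  qed measurable
  obtain B where B: "\<And>i. u i \<le> B"
    using convergent_imp_bounded[OF u(2)] by (force simp: bounded_iff abs_le_iff)
  \<comment> \<open>A common upper bound for \<open>a\<close>, \<open>x\<close> and all
    \<open>u i\<close>: after adding \<open>M'\<close>, one Lipschitz constant serves for the whole
    sequence.\<close>
  define z where "z = Max {a, B, x}"
  let ?s = "\<lambda>i \<omega>. (f (u i + M' \<omega>) - f (x + M' \<omega>)) / (u i - x)"
  have "(\<lambda>i. expectation (?s i)) \<longlonglongrightarrow> expectation (\<lambda>\<omega>. D (M' \<omega>))"
  proof (rule integral_dominated_convergence)
    show "integrable M (\<lambda>\<omega>. C * exp (\<alpha> * z) * exp (\<alpha> * M' \<omega>))"
      using integrable by simp
    show "AE \<omega> in M. (\<lambda>i. ?s i \<omega>) \<longlonglongrightarrow> D (M' \<omega>)"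
      using nonneg
    proof eventually_elim
      case (elim \<omega>)
      with D[OF elim] u show ?case
        unfolding has_field_derivative_iff tendsto_at_iff_sequentially by (auto simp: comp_def)
    qed
    show "AE \<omega> in M. norm (?s i \<omega>) \<le> C * exp (\<alpha> * z) * exp (\<alpha> * M' \<omega>)" for i
      using nonneg
    proof eventually_elim
      case (elim \<omega>)
      have "a \<le> z" "u i \<le> z" "x \<le> z" using B[of i] by (auto simp: z_def)
      then have "\<bar>f (u i + M' \<omega>) - f (x + M' \<omega>)\<bar>
          \<le> C * exp (\<alpha> * (z + M' \<omega>)) * \<bar>u i + M' \<omega> - (x + M' \<omega>)\<bar>"
        using elim by (intro exp_lipschitz_of_deriv_bound[OF zero deriv bound C \<alpha>]) auto
      moreover have "0 < \<bar>u i - x\<bar>" using u(1) by auto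
      ultimately show ?case
        by (simp add: divide_le_eq distrib_left exp_add mult_ac)
    qed
  qed measurable
  moreover have "expectation (\<lambda>\<omega>. f (u i + M' \<omega>) - f (x + M' \<omega>))
      = expectation (\<lambda>\<omega>. f (u i + M' \<omega>)) - expectation (\<lambda>\<omega>. f (x + M' \<omega>))" for i
    by (intro Bochner_Integration.integral_diff f_integrable)
  ultimately show "((\<lambda>y. (expectation (\<lambda>\<omega>. f (y + M' \<omega>)) - expectation (\<lambda>\<omega>. f (x + M' \<omega>))) / (y - x)) \<circ> u)
      \<longlonglongrightarrow> expectation (\<lambda>\<omega>. D (M' \<omega>))"
    by (simp add: comp_def)
qed

section \<open>One-sided derivatives of the value function\<close>

theorem theorem2:
  fixes P :: "real \<Rightarrow> 'a measure" and X :: "real \<Rightarrow> 'a \<Rightarrow> real" and e :: "'a \<Rightarrow> real"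
    and r x\<^sub>0 A \<alpha> :: real and g Q Q' Q'' V :: "real \<Rightarrow> real"
  assumes r_pos: "r > 0"
    and levy: "levy_family r P X e"
    and g_cont: "continuous_on UNIV g" and g_nonneg: "\<And>x. g x \<ge> 0"
    and Q_cont: "continuous_on UNIV Q" and Q_mono: "mono Q"
    and Q_zero: "\<And>x. x \<le> x\<^sub>0 \<Longrightarrow> Q x = 0"
    and g_eq: "\<And>x. x \<ge> x\<^sub>0 \<Longrightarrow>
          has_bochner_integral (P x) (\<lambda>\<omega>. Q (sup_until X e \<omega>)) (g x)"
    and Q_deriv: "\<And>x. x \<ge> x\<^sub>0 \<Longrightarrow> (Q has_real_derivative Q' x) (at x within {x\<^sub>0..})"
    and Q'_deriv: "\<And>x. x \<ge> x\<^sub>0 \<Longrightarrow> (Q' has_real_derivative Q'' x) (at x within {x\<^sub>0..})"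
    and Q''_cont: "continuous_on {x\<^sub>0..} Q''"
    and A_pos: "A > 0" and \<alpha>_pos: "\<alpha> > 0"
    and Q''_bound: "\<And>x. x \<ge> x\<^sub>0 \<Longrightarrow> \<bar>Q'' x\<bar> \<le> A * exp (\<alpha> * x)"
    and exp_moment: "(\<integral>\<^sup>+\<omega>. ennreal (exp (\<alpha> * X 1 \<omega>)) \<partial>P 0) < ennreal (exp r)"
    and V_def: "\<And>x. V x = (\<integral>\<omega>. Q (sup_until X e \<omega>) \<partial>P x)"
  shows "(\<exists>Vr Vl. (V has_real_derivative Vr) (at_right x\<^sub>0) \<and>
                  (V has_real_derivative Vl) (at_left x\<^sub>0) \<and>
                  Vr - Vl = Q' x\<^sub>0 * measure (P 0) {\<omega> \<in> space (P 0). sup_until X e \<omega> = 0}) \<and>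
         (\<forall>x>x\<^sub>0. \<exists>Vr Vl. (V has_real_derivative Vr) (at_right x) \<and>
                  (V has_real_derivative Vl) (at_left x) \<and> Vr - Vl = 0)"
proof -
  have levy_P0: "levy_process (P 0) X" and exp: "distributed (P 0) lborel e (exponential_density r)"
    and indep: "indep_of_process (P 0) e X"
    using levy by (auto simp: levy_family_def)
  interpret prob_space "P 0" using levy_P0 by (simp add: levy_process_def)
  let ?M = "sup_until X e"
  have M[measurable]: "random_variable borel ?M"
    by (rule levy_family_sup_until_measurable[OF levy r_pos])
  have Q[measurable]: "Q \<in> borel_measurable borel"
    by (rule borel_measurable_continuous_onI[OF Q_cont])
  have V_eq: "V = (\<lambda>x. expectation (\<lambda>\<omega>. Q (x + ?M \<omega>)))"
    unfolding V_def by (intro ext levy_family_integral_sup_until[OF levy r_pos Q])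
  have M_nonneg: "AE \<omega> in P 0. 0 \<le> ?M \<omega>"
    by (rule levy_process_sup_until_nonneg[OF levy_P0 exp r_pos])
  have exp_integrable: "integrable (P 0) (\<lambda>\<omega>. exp (\<alpha> * ?M \<omega>))"
    using levy_process_sup_until_exp_moment[OF levy_P0 indep exp r_pos \<alpha>_pos exp_moment]
    by (intro integrableI_bounded) auto
  obtain C where C: "0 \<le> C" "\<And>x. x\<^sub>0 \<le> x \<Longrightarrow> \<bar>Q' x\<bar> \<le> C * exp (\<alpha> * x)"
    using exp_growth_of_deriv_bound[OF Q'_deriv Q''_bound less_imp_le[OF A_pos] \<alpha>_pos] by blast
  \<comment> \<open>Extending \<open>Q'\<close> by the constant \<open>Q' x\<^sub>0\<close> to the
    left keeps it continuous on the whole line, hence Borel.\<close>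
  define q where "q y = Q' (max x\<^sub>0 y)" for y
  have q_eq: "q y = Q' y" if "x\<^sub>0 \<le> y" for y using that by (simp add: q_def max_def)
  have "continuous_on {x\<^sub>0..} Q'"
    using Q'_deriv by (intro DERIV_continuous_on) auto
  then have "continuous_on UNIV q"
    unfolding q_def
    by (rule continuous_on_compose2[where g = Q']) (auto intro: continuous_on_max)
  then have [measurable]: "q \<in> borel_measurable borel"
    by (rule borel_measurable_continuous_onI)
  have V_deriv: "(V has_real_derivative expectation (\<lambda>\<omega>. D (?M \<omega>))) (at x within S)"
    if "D \<in> borel_measurable borel"
      "\<And>m. 0 \<le> m \<Longrightarrow> ((\<lambda>y. Q (y + m)) has_real_derivative D m) (at x within S)" for D x S
    unfolding V_eq
    by (rule has_real_derivative_expectation_shift[OF M Q that(1) M_nonneg exp_integrable Q_zero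
          Q_deriv C(2) C(1) \<alpha>_pos that(2)])
  have Q_deriv_at: "(Q has_real_derivative q y) (at y)" if "x\<^sub>0 < y" for y
    using Q_deriv[of y] that at_within_interior[of y "{x\<^sub>0..}"] by (simp add: q_eq)
  \<comment> \<open>For \<open>x > x\<^sub>0\<close> and \<open>M \<ge> 0\<close> the point
    \<open>x + M\<close> stays to the right of the kink, so \<open>V\<close> has a two-sided
    derivative at \<open>x\<close>.\<close>
  have interior: "\<exists>Vr Vl. (V has_real_derivative Vr) (at_right x) \<and>
      (V has_real_derivative Vl) (at_left x) \<and> Vr - Vl = 0" if x: "x\<^sub>0 < x" for x
  proof -
    have "(V has_real_derivative expectation (\<lambda>\<omega>. q (x + ?M \<omega>))) (at x)"
      by (rule V_deriv[of "\<lambda>m. q (x + m)"])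
        (use x in \<open>auto intro!: has_real_derivative_shift_within[OF Q_deriv_at]\<close>)
    then show ?thesis
      by (meson has_field_derivative_at_within diff_self)
  qed
  \<comment> \<open>For \<open>m \<ge> 0\<close>, \<open>D m\<close> is the left derivative of
    \<open>Q (y + m)\<close> at \<open>y = x\<^sub>0\<close>: zero for \<open>m = 0\<close>, because
    \<open>Q\<close> vanishes to the left, and the ordinary derivative of \<open>Q\<close> at
    \<open>x\<^sub>0 + m\<close> for \<open>m > 0\<close>.\<close>
  define D where "D m = (if m = 0 then 0 else q (x\<^sub>0 + m))" for m
  have right: "(V has_real_derivative expectation (\<lambda>\<omega>. q (x\<^sub>0 + ?M \<omega>))) (at_right x\<^sub>0)"
  proof (rule V_deriv[of "\<lambda>m. q (x\<^sub>0 + m)"])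
    fix m :: real assume "0 \<le> m"
    then show "((\<lambda>y. Q (y + m)) has_real_derivative q (x\<^sub>0 + m)) (at_right x\<^sub>0)"
      using Q_deriv[of "x\<^sub>0 + m"] q_eq[of "x\<^sub>0 + m"]
      by (intro has_real_derivative_shift_within[where T = "{x\<^sub>0..}"]) auto
  qed measurable
  have left: "(V has_real_derivative expectation (\<lambda>\<omega>. D (?M \<omega>))) (at_left x\<^sub>0)"
  proof (rule V_deriv)
    fix m :: real assume m: "0 \<le> m"
    show "((\<lambda>y. Q (y + m)) has_real_derivative D m) (at_left x\<^sub>0)"
    proof (cases "m = 0")
      case True
      have "(Q has_real_derivative 0) (at x\<^sub>0 within {..x\<^sub>0})"
        by (rule has_field_derivative_transform_within[where f = "\<lambda>_. 0" and d = 1]) (auto simp: Q_zero)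
      then have "(Q has_real_derivative 0) (at_left x\<^sub>0)"
        by (rule DERIV_subset) auto
      then show ?thesis using True by (simp add: D_def)
    next
      case False
      then show ?thesis
        using m by (auto simp: D_def intro!: has_real_derivative_shift_within[OF Q_deriv_at])
    qed
  qed (unfold D_def, measurable)
  have q_integrable: "integrable (P 0) (\<lambda>\<omega>. q (x\<^sub>0 + ?M \<omega>))"
  proof (rule Bochner_Integration.integrable_bound)
    show "integrable (P 0) (\<lambda>\<omega>. C * exp (\<alpha> * x\<^sub>0) * exp (\<alpha> * ?M \<omega>))"
      using exp_integrable by simp
    show "AE \<omega> in P 0. norm (q (x\<^sub>0 + ?M \<omega>)) \<le> norm (C * exp (\<alpha> * x\<^sub>0) * exp (\<alpha> * ?M \<omega>))"
      using M_nonneg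
    proof eventually_elim
      case (elim \<omega>)
      then show ?case
        using C(2)[of "x\<^sub>0 + ?M \<omega>"] C(1)
        by (simp add: q_eq abs_mult distrib_left exp_add mult.assoc)
    qed
  qed measurable
  let ?Z = "{\<omega> \<in> space (P 0). ?M \<omega> = 0}"
  \<comment> \<open>The integrands of the two one-sided derivatives differ only where
    \<open>M = 0\<close>, and there by \<open>q x\<^sub>0 = Q' x\<^sub>0\<close>.\<close>
  have "expectation (\<lambda>\<omega>. D (?M \<omega>)) = expectation (\<lambda>\<omega>. q (x\<^sub>0 + ?M \<omega>) - Q' x\<^sub>0 * indicator ?Z \<omega>)"
    by (intro Bochner_Integration.integral_cong) (auto simp: D_def q_eq)
  also have "\<dots> = expectation (\<lambda>\<omega>. q (x\<^sub>0 + ?M \<omega>)) - expectation (\<lambda>\<omega>. Q' x\<^sub>0 * indicator ?Z \<omega>)"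
    by (intro Bochner_Integration.integral_diff q_integrable) (auto simp: emeasure_eq_measure)
  also have "expectation (\<lambda>\<omega>. Q' x\<^sub>0 * indicator ?Z \<omega>) = Q' x\<^sub>0 * prob ?Z"
    by simp
  finally have "expectation (\<lambda>\<omega>. q (x\<^sub>0 + ?M \<omega>)) - expectation (\<lambda>\<omega>. D (?M \<omega>)) = Q' x\<^sub>0 * prob ?Z"
    by simp
  with right left interior show ?thesis
    by blast
qed

end
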